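(* Let $G$ be an abelian group. A function $\phi:G\to\mathbb{H}$ is positive definite if and only if there exists a (not necessarily unique) nonnegative finite Radon measure $\mu$ on $G^\delta$ such that $$\phi(g)=\int_{G^\delta}\gamma(g)\,d\mu(\gamma)\quad\text{for all } g\in G.$$
   Context: $\mathbb{H}$ is the real quaternion algebra, $\mathbb{S}=\{q\in\mathbb{H}:|q|=1\}$. For an abelian group $G$, $\phi:G\to\mathbb{H}$ is positive definite if for all $k$, $g_i\in G$, $q_i\in\mathbb{H}$, $\sum_{i,j=1}^k\overline{q_i}\,\phi(g_j-g_i)\,q_j$ is a nonnegative real number. The quaternionic dual $G^\delta=\mathrm{Hom}(G,\mathbb{S})$ is the set of group homomorphisms $G\to\mathbb{S}$, equipped with the topology of pointwise convergence (it is a compact Hausdorff space). Integrals of $\mathbb{H}$-valued functions are taken componentwise. *)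

theory Defs
  imports "HOL-Analysis.Analysis"
begin

text \<open>Real quaternions are represented as vectors in real^4:
  component 1 = real part, components 2,3,4 = i,j,k parts.
  The Euclidean norm on real^4 is the quaternion modulus.\<close>

type_synonym quat = "real ^ 4"

definition qmul :: "quat \<Rightarrow> quat \<Rightarrow> quat" where
  "qmul p q = (\<chi> n. if n = 1 then p$1*q$1 - p$2*q$2 - p$3*q$3 - p$4*q$4
                 else if n = 2 then p$1*q$2 + p$2*q$1 + p$3*q$4 - p$4*q$3
                 else if n = 3 then p$1*q$3 - p$2*q$4 + p$3*q$1 + p$4*q$2
                 else p$1*q$4 + p$2*q$3 - p$3*q$2 + p$4*q$1)"

definition qcnj :: "quat \<Rightarrow> quat" where
  "qcnj q = (\<chi> n. if n = 1 then q$1 else - (q$n))"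

definition qnonneg_real :: "quat \<Rightarrow> bool" where
  "qnonneg_real q \<longleftrightarrow> q$2 = 0 \<and> q$3 = 0 \<and> q$4 = 0 \<and> q$1 \<ge> 0"

definition pos_def :: "('g::ab_group_add \<Rightarrow> quat) \<Rightarrow> bool" where
  "pos_def \<phi> \<longleftrightarrow> (\<forall>(k::nat) (g::nat \<Rightarrow> 'g) (q::nat \<Rightarrow> quat).
     qnonneg_real (\<Sum>i\<in>{1..k}. \<Sum>j\<in>{1..k}. qmul (qmul (qcnj (q i)) (\<phi> (g j - g i))) (q j)))"

definition qdual :: "('g::ab_group_add \<Rightarrow> quat) set" where
  "qdual = {\<gamma>. (\<forall>a. norm (\<gamma> a) = 1) \<and> (\<forall>a b. \<gamma> (a + b) = qmul (\<gamma> a) (\<gamma> b))}"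

definition qdual_top :: "('g::ab_group_add \<Rightarrow> quat) topology" where
  "qdual_top = subtopology (product_topology (\<lambda>_. euclidean) UNIV) qdual"

text \<open>Radon measure on a topological space (Folland): Borel, outer regular on all
  Borel sets, inner regular (by compact sets) on open sets.\<close>
definition radon_on :: "'a topology \<Rightarrow> 'a measure \<Rightarrow> bool" where
  "radon_on T M \<longleftrightarrow>
     space M = topspace T \<and>
     sets M = sigma_sets (topspace T) {U. openin T U} \<and>
     (\<forall>A\<in>sets M. emeasure M A = (INF U\<in>{U. openin T U \<and> A \<subseteq> U}. emeasure M U)) \<and>
     (\<forall>U. openin T U \<longrightarrow> emeasure M U = (SUP K\<in>{K. compactin T K \<and> K \<subseteq> U}. emeasure M K))"

end

theory Submission
  imports Defs
begin

text \<open>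
  If \<open>\<mu>\<close> represents \<open>\<phi>\<close>, the quadratic form of \<open>\<phi>\<close> is the integral of
  \<open>|\<Sum>\<^sub>i \<gamma>(g\<^sub>i) q\<^sub>i|\<^sup>2\<close>. For the converse, let \<open>P\<close> be the compact convex set of positive definite
  functions with \<open>\<phi>(0) = 1\<close>. The function \<open>\<phi>(x) + c\<^sup>* \<phi>(x) c \<plusminus> (\<phi>(x+a) c + c\<^sup>* \<phi>(x-a))\<close> is positive
  definite, so if \<open>\<phi>\<close> is extreme in \<open>P\<close> and the unit quaternion \<open>c\<close> commutes with all \<open>\<phi>(x)\<close>, then
  \<open>\<phi>(x+a) c + c\<^sup>* \<phi>(x-a)\<close> is a real multiple of \<open>\<phi>(x)\<close>. Taking \<open>c = 1\<close> gives d'Alembert's equation,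
  which forces the imaginary parts of \<open>\<phi>\<close> to be parallel to one imaginary unit \<open>u\<close>; taking \<open>c = u\<close>
  then gives \<open>\<phi>(x+a) = \<phi>(a) \<phi>(x)\<close>. Hence every extreme point of \<open>P\<close> lies in the quaternionic dual.

  By the Krein-Milman argument and a nearest-point argument on finite subsets of the group, every
  element of \<open>P\<close> is the barycenter of a positive normalized functional on the bounded functions on
  the dual. Such a functional yields a finitely additive set function \<open>m\<close>; the measure whose value on
  an open set is the supremum of \<open>m\<close> over its closed subsets is Radon and integrates continuous
  functions as the functional does.
\<close>

section \<open>Positive definite quaternionic functions\<close>

lemma qmul_nth [simp]:
  "qmul p q $ 1 = p$1*q$1 - p$2*q$2 - p$3*q$3 - p$4*q$4"
  "qmul p q $ 2 = p$1*q$2 + p$2*q$1 + p$3*q$4 - p$4*q$3"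
  "qmul p q $ 3 = p$1*q$3 - p$2*q$4 + p$3*q$1 + p$4*q$2"
  "qmul p q $ 4 = p$1*q$4 + p$2*q$3 - p$3*q$2 + p$4*q$1"
  by (simp_all add: qmul_def)

lemma qcnj_nth [simp]:
  "qcnj q $ 1 = q$1" "qcnj q $ 2 = - q$2" "qcnj q $ 3 = - q$3" "qcnj q $ 4 = - q$4"
  by (simp_all add: qcnj_def)

text \<open>\<open>axis 1 r\<close> is the real number \<open>r\<close> viewed as a quaternion; real
  scalars appear below in this form.\<close>

lemma axis_1_nth [simp]:
  "axis (1::4) (r::real) $ 1 = r" "axis (1::4) r $ 2 = 0"
  "axis (1::4) r $ 3 = 0" "axis (1::4) r $ 4 = 0"
  by (simp_all add: axis_def)

lemma quat_eq_iff: "p = q \<longleftrightarrow> p$1 = q$1 \<and> p$2 = q$2 \<and> p$3 = q$3 \<and> p$4 = q$4" for p q :: quat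
  by (simp add: vec_eq_iff forall_4)

lemma norm_quat: "(norm q)\<^sup>2 = (q$1)\<^sup>2 + (q$2)\<^sup>2 + (q$3)\<^sup>2 + (q$4)\<^sup>2" for q :: quat
  unfolding power2_norm_eq_inner by (simp add: inner_vec_def sum_4 power2_eq_square)

text \<open>After squaring, this is Euler's four-square identity.\<close>

lemma norm_qmul: "norm (qmul p q) = norm p * norm q"
proof -
  have "(norm (qmul p q))\<^sup>2 = (norm p * norm q)\<^sup>2"
    unfolding power_mult_distrib norm_quat qmul_nth by algebra
  then show ?thesis by simp
qed

lemma norm_qcnj [simp]: "norm (qcnj q) = norm q"
proof -
  have "(norm (qcnj q))\<^sup>2 = (norm q)\<^sup>2" by (simp add: norm_quat)
  then show ?thesis by simp
qed

interpretation qmul: bounded_bilinear qmul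
proof
  show "\<exists>K. \<forall>a b. norm (qmul a b) \<le> norm a * norm b * K"
    by (intro exI[of _ 1]) (simp add: norm_qmul)
qed (simp_all add: quat_eq_iff algebra_simps)

lemma linear_qcnj: "linear qcnj"
  by (rule linearI) (simp_all add: quat_eq_iff)

lemma qmul_assoc: "qmul (qmul p q) r = qmul p (qmul q r)"
  by (simp add: quat_eq_iff algebra_simps)

lemma qcnj_qmul: "qcnj (qmul p q) = qmul (qcnj q) (qcnj p)"
  by (simp add: quat_eq_iff algebra_simps)

lemma qmul_axis_1 [simp]: "qmul (axis 1 r) q = r *\<^sub>R q" "qmul q (axis 1 r) = r *\<^sub>R q"
  by (simp_all add: quat_eq_iff)

lemma qcnj_axis_1 [simp]: "qcnj (axis 1 r) = axis 1 r"
  by (simp add: quat_eq_iff)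

lemma qmul_qcnj: "qmul (qcnj q) q = axis 1 ((norm q)\<^sup>2)" "qmul q (qcnj q) = axis 1 ((norm q)\<^sup>2)"
  unfolding norm_quat by (simp_all add: quat_eq_iff power2_eq_square)

section \<open>Positive definite functions: scaling, translates, symmetry and boundedness\<close>

lemma qnonneg_real_iff: "qnonneg_real q \<longleftrightarrow> q = axis 1 (q$1) \<and> 0 \<le> q$1"
  by (auto simp: qnonneg_real_def quat_eq_iff)

lemma qnonneg_real_scaleR: "0 \<le> r \<Longrightarrow> qnonneg_real q \<Longrightarrow> qnonneg_real (r *\<^sub>R q)"
  by (simp add: qnonneg_real_def)

text \<open>Any finite index set can be enumerated by \<open>{1..k}\<close>. This allows families
  indexed by pairs, as in the doubling of points by a translation.\<close>

lemma pos_def_finite_sum: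
  fixes \<phi> :: "'g::ab_group_add \<Rightarrow> quat" and g :: "'i \<Rightarrow> 'g"
  assumes "pos_def \<phi>" and "finite I"
  shows "qnonneg_real (\<Sum>i\<in>I. \<Sum>j\<in>I. qmul (qmul (qcnj (q i)) (\<phi> (g j - g i))) (q j))"
proof -
  obtain h where h: "bij_betw h {1..card I} I"
    using ex_bij_betw_nat_finite_1[OF assms(2)] by blast
  have "(\<Sum>i\<in>I. \<Sum>j\<in>I. qmul (qmul (qcnj (q i)) (\<phi> (g j - g i))) (q j)) =
    (\<Sum>i\<in>{1..card I}. \<Sum>j\<in>{1..card I}.
        qmul (qmul (qcnj ((q \<circ> h) i)) (\<phi> ((g \<circ> h) j - (g \<circ> h) i))) ((q \<circ> h) j))"
    unfolding comp_def
    by (subst sum.reindex_bij_betw[OF h, symmetric], intro sum.cong refl)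
       (subst sum.reindex_bij_betw[OF h, symmetric], simp)
  moreover have "qnonneg_real \<dots>"
    using assms(1) unfolding pos_def_def by (elim allE)
  ultimately show ?thesis by simp
qed

lemma pos_def_scaleR:
  assumes "pos_def \<phi>" "0 \<le> r"
  shows "pos_def (\<lambda>x. r *\<^sub>R \<phi> x)"
proof -
  have eq: "(\<Sum>i\<in>{1..k}. \<Sum>j\<in>{1..k}. qmul (qmul (qcnj (q i)) (r *\<^sub>R \<phi> (g j - g i))) (q j)) =
     r *\<^sub>R (\<Sum>i\<in>{1..k}. \<Sum>j\<in>{1..k}. qmul (qmul (qcnj (q i)) (\<phi> (g j - g i))) (q j))" for k g q
    by (simp add: scaleR_sum_right qmul.scaleR_left qmul.scaleR_right)
  show ?thesis
    unfolding pos_def_def eq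
    by (intro allI qnonneg_real_scaleR[OF assms(2)] pos_def_finite_sum[OF assms(1)] finite_atLeastAtMost)
qed

text \<open>The quadratic form of the new function at \<open>(g\<^sub>i, q\<^sub>i)\<close> is that of \<open>\<phi>\<close> at the points
  \<open>(g\<^sub>i, q\<^sub>i)\<close> and \<open>(g\<^sub>i + a, c q\<^sub>i)\<close> together.\<close>

lemma pos_def_translate:
  fixes \<phi> :: "'g::ab_group_add \<Rightarrow> quat"
  assumes "pos_def \<phi>"
  shows "pos_def (\<lambda>x. \<phi> x + qmul (qmul (qcnj c) (\<phi> x)) c + qmul (\<phi> (x + a)) c + qmul (qcnj c) (\<phi> (x - a)))"
  unfolding pos_def_def
proof (intro allI)
  fix k :: nat and g :: "nat \<Rightarrow> 'g" and q :: "nat \<Rightarrow> quat"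
  define G where "G = (\<lambda>(i, b). if b then g i + a else g i)"
  define Q where "Q = (\<lambda>(i, b). if b then qmul c (q i) else q i)"
  let ?I = "{1..k} \<times> (UNIV :: bool set)"
  have "(\<Sum>i\<in>?I. \<Sum>j\<in>?I. qmul (qmul (qcnj (Q i)) (\<phi> (G j - G i))) (Q j)) =
    (\<Sum>i\<in>{1..k}. \<Sum>b\<in>UNIV. \<Sum>j\<in>{1..k}. \<Sum>d\<in>UNIV.
        qmul (qmul (qcnj (Q (i, b))) (\<phi> (G (j, d) - G (i, b)))) (Q (j, d)))"
    unfolding sum.cartesian_product' ..
  also have "\<dots> = (\<Sum>i\<in>{1..k}. \<Sum>j\<in>{1..k}. \<Sum>b\<in>UNIV. \<Sum>d\<in>UNIV.
        qmul (qmul (qcnj (Q (i, b))) (\<phi> (G (j, d) - G (i, b)))) (Q (j, d)))"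
    by (intro sum.cong refl sum.swap)
  also have "\<dots> = (\<Sum>i\<in>{1..k}. \<Sum>j\<in>{1..k}. qmul (qmul (qcnj (q i))
      (\<phi> (g j - g i) + qmul (qmul (qcnj c) (\<phi> (g j - g i))) c + qmul (\<phi> (g j - g i + a)) c
        + qmul (qcnj c) (\<phi> (g j - g i - a)))) (q j))"
  proof (intro sum.cong refl)
    fix i j
    have e: "g j + a - g i = g j - g i + a" "g j - (g i + a) = g j - g i - a"
      by (simp_all add: algebra_simps)
    show "(\<Sum>b\<in>UNIV. \<Sum>d\<in>UNIV.
        qmul (qmul (qcnj (Q (i, b))) (\<phi> (G (j, d) - G (i, b)))) (Q (j, d))) =
      qmul (qmul (qcnj (q i))
      (\<phi> (g j - g i) + qmul (qmul (qcnj c) (\<phi> (g j - g i))) c + qmul (\<phi> (g j - g i + a)) c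
        + qmul (qcnj c) (\<phi> (g j - g i - a)))) (q j)"
      by (simp add: UNIV_bool G_def Q_def qmul.add_left qmul.add_right qmul_assoc qcnj_qmul e)
  qed
  finally show "qnonneg_real (\<Sum>i\<in>{1..k}. \<Sum>j\<in>{1..k}. qmul (qmul (qcnj (q i))
      (\<phi> (g j - g i) + qmul (qmul (qcnj c) (\<phi> (g j - g i))) c + qmul (\<phi> (g j - g i + a)) c
        + qmul (qcnj c) (\<phi> (g j - g i - a)))) (q j))"
    using pos_def_finite_sum[OF assms, of ?I Q G] by simp
qed

lemma pos_def_zero: "pos_def \<phi> \<Longrightarrow> qnonneg_real (\<phi> 0)"
  using pos_def_finite_sum[of \<phi> "{()}" "\<lambda>_. axis 1 1" "\<lambda>_. 0"] by simp

lemma pos_def_zero_eq: "pos_def \<phi> \<Longrightarrow> \<phi> 0 = axis 1 (\<phi> 0 $ 1)"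
  using pos_def_zero qnonneg_real_iff by blast

text \<open>The translate built from \<open>c\<close> has a real value at 0, so
  \<open>\<phi> a c + c* \<phi>(-a)\<close> has no imaginary part. Taking \<open>c = 1\<close>
  compares the imaginary parts of \<phi>(a) and \<phi>(-a), and taking \<open>c = i\<close> compares
  their real parts.\<close>

lemma pos_def_uminus:
  assumes "pos_def \<phi>"
  shows "\<phi> (- a) = qcnj (\<phi> a)"
proof -
  have *: "qnonneg_real (\<phi> 0 + qmul (qmul (qcnj c) (\<phi> 0)) c + qmul (\<phi> a) c + qmul (qcnj c) (\<phi> (- a)))" for c
    using pos_def_zero[OF pos_def_translate[OF assms, of c a]] by simp
  have z: "\<phi> 0 $ 2 = 0" "\<phi> 0 $ 3 = 0" "\<phi> 0 $ 4 = 0"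
    using pos_def_zero[OF assms] by (auto simp: qnonneg_real_def)
  show ?thesis
    using *[of "axis 1 1"] *[of "axis 2 1"] z
    by (simp add: qnonneg_real_def quat_eq_iff axis_def)
qed

lemma norm_pos_def_le:
  assumes "pos_def \<phi>"
  shows "norm (\<phi> a) \<le> \<phi> 0 $ 1"
proof (cases "\<phi> a = 0")
  case True
  then show ?thesis using pos_def_zero[OF assms] by (simp add: qnonneg_real_def)
next
  case False
  \<comment> \<open>This unit quaternion rotates \<open>\<phi> a\<close> onto the negative real
    axis, so the value of the translate at 0 becomes
    \<open>2 \<phi>(0) - 2 |\<phi>(a)|\<close>.\<close>
  define c where "c = (- 1 / norm (\<phi> a)) *\<^sub>R qcnj (\<phi> a)"
  have "norm c = 1" using False by (simp add: c_def)
  then have "qmul (qmul (qcnj c) (\<phi> 0)) c = \<phi> 0"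
    by (subst (1 2) pos_def_zero_eq[OF assms])
       (simp add: qmul_qcnj quat_eq_iff qmul.scaleR_left del: qmul_nth)
  moreover have "qmul (\<phi> a) c = axis 1 (- norm (\<phi> a))"
    unfolding c_def qmul.scaleR_right qmul_qcnj
    using False by (simp add: quat_eq_iff power2_eq_square)
  moreover have "qmul (qcnj c) (\<phi> (- a)) = qcnj (qmul (\<phi> a) c)"
    by (simp add: qcnj_qmul pos_def_uminus[OF assms])
  ultimately show ?thesis
    using pos_def_zero[OF pos_def_translate[OF assms, of c a]]
    by (simp add: qnonneg_real_def)
qed

section \<open>Extreme normalized positive definite functions\<close>

definition extreme_in :: "('a \<Rightarrow> 'b::real_vector) set \<Rightarrow> ('a \<Rightarrow> 'b) \<Rightarrow> bool" where
  "extreme_in K p \<longleftrightarrow> p \<in> K \<and>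
    (\<forall>q\<in>K. \<forall>r\<in>K. \<forall>t. 0 < t \<and> t < 1 \<and> p = (\<lambda>x. (1 - t) *\<^sub>R q x + t *\<^sub>R r x) \<longrightarrow> q = p)"

lemma extreme_in_mem: "extreme_in K p \<Longrightarrow> p \<in> K"
  unfolding extreme_in_def by (rule conjunct1)

lemma extreme_inD:
  assumes "extreme_in K p" "q \<in> K" "r \<in> K" "0 < t" "t < 1"
    and "p = (\<lambda>x. (1 - t) *\<^sub>R q x + t *\<^sub>R r x)"
  shows "q = p"
proof -
  have "0 < t \<and> t < 1 \<and> p = (\<lambda>x. (1 - t) *\<^sub>R q x + t *\<^sub>R r x) \<longrightarrow> q = p"
    using assms(1,2,3) unfolding extreme_in_def by simp
  then show ?thesis using assms(4-6) by simp
qed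

definition pos_def_normalized :: "('g::ab_group_add \<Rightarrow> quat) set" where
  "pos_def_normalized = {\<phi>. pos_def \<phi> \<and> \<phi> 0 = axis 1 1}"

lemma pos_def_normalize:
  assumes "pos_def \<psi>" "\<psi> 0 $ 1 = r" "0 < r"
  shows "(\<lambda>x. (1 / r) *\<^sub>R \<psi> x) \<in> pos_def_normalized"
proof -
  have "pos_def (\<lambda>x. (1 / r) *\<^sub>R \<psi> x)"
    using assms by (intro pos_def_scaleR) auto
  moreover have "(1 / r) *\<^sub>R \<psi> 0 = axis 1 1"
    using assms(2,3) pos_def_zero[OF assms(1)] by (simp add: quat_eq_iff qnonneg_real_def)
  ultimately show ?thesis by (simp add: pos_def_normalized_def)
qed

text \<open>Let \<open>D\<close> be the left-hand side as a function of \<open>x\<close>. Since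
  \<open>c\<close> is a unit commuting with the values of \<phi>, the translates for
  \<open>c\<close> and \<open>-c\<close> are \<open>2 \<phi> + D\<close> and
  \<open>2 \<phi> - D\<close>. Both are positive definite and they average to
  \<open>2 \<phi>\<close>, so extremality makes \<open>D\<close> a multiple of \<phi>; the factor is
  read off at 0.\<close>

lemma extreme_translate:
  fixes \<phi> :: "'g::ab_group_add \<Rightarrow> quat"
  assumes extr: "extreme_in pos_def_normalized \<phi>"
    and c: "norm c = 1" and comm: "\<And>x. qmul c (\<phi> x) = qmul (\<phi> x) c"
  shows "qmul (\<phi> (x + a)) c + qmul (qcnj c) (\<phi> (x - a)) = (2 * (qmul (\<phi> a) c $ 1)) *\<^sub>R \<phi> x"
proof -
  have pd: "pos_def \<phi>" and \<phi>0: "\<phi> 0 = axis 1 1"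
    using extreme_in_mem[OF extr] by (simp_all add: pos_def_normalized_def)
  define D where "D x = qmul (\<phi> (x + a)) c + qmul (qcnj c) (\<phi> (x - a))" for x
  define d where "d = qmul (\<phi> a) c $ 1"
  \<comment> \<open>With \<open>q = \<phi>(a) c\<close>, the second summand of \<open>D 0\<close> is
    the conjugate of \<open>q\<close>, which leaves twice the real part of \<open>q\<close>.\<close>
  have D0: "D 0 = axis 1 (2 * d)"
    using qcnj_qmul[of "\<phi> a" c, symmetric] pos_def_uminus[OF pd, of a]
    by (simp add: D_def d_def quat_eq_iff)
  have conj: "qmul (qmul (qcnj c) (\<phi> x)) c = \<phi> x" for x
    using c by (simp add: qmul_assoc flip: comm) (simp add: qmul_qcnj flip: qmul_assoc)
  have pd1: "pos_def (\<lambda>x. 2 *\<^sub>R \<phi> x + D x)"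
    using pos_def_translate[OF pd, of c a] by (simp add: conj D_def add.assoc scaleR_2)
  have pd2: "pos_def (\<lambda>x. 2 *\<^sub>R \<phi> x - D x)"
    using pos_def_translate[OF pd, of "- c" a]
    by (simp add: conj D_def scaleR_2 linear_neg[OF linear_qcnj] qmul.minus_left qmul.minus_right algebra_simps)
  have le: "norm (2 *\<^sub>R \<phi> x + D x) \<le> 2 + 2 * d" "norm (2 *\<^sub>R \<phi> x - D x) \<le> 2 - 2 * d" for x
    using norm_pos_def_le[OF pd1, of x] norm_pos_def_le[OF pd2, of x] by (simp_all add: D0 \<phi>0)
  have "D x = (2 * d) *\<^sub>R \<phi> x"
  proof -
    \<comment> \<open>In the two boundary cases one of the functions vanishes at 0, hence everywhere
      by \<open>le\<close>, and cannot be normalized; the claim then holds directly.\<close>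
    consider "d = 1" | "d = -1" | "-1 < d" "d < 1"
      using order_trans[OF norm_ge_zero le(1)] order_trans[OF norm_ge_zero le(2)] by fastforce
    then show ?thesis
    proof cases
      case 1
      then show ?thesis using le(2)[of x] by simp
    next
      case 2
      then show ?thesis using le(1)[of x] by (simp add: add_eq_0_iff)
    next
      case 3
      let ?q = "\<lambda>x. (1 / (2 + 2 * d)) *\<^sub>R (2 *\<^sub>R \<phi> x + D x)"
      let ?r = "\<lambda>x. (1 / (2 - 2 * d)) *\<^sub>R (2 *\<^sub>R \<phi> x - D x)"
      \<comment> \<open>The weights \<open>(1 + d) / 2\<close> and \<open>(1 - d) / 2\<close> cancel
        the normalizations, so that both functions enter with coefficient 1/4 and \<open>D\<close>
        drops out.\<close>
      define t where "t = (1 - d) / 2"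
      have q: "?q \<in> pos_def_normalized"
        by (rule pos_def_normalize[OF pd1]) (use 3 in \<open>auto simp: D0 \<phi>0\<close>)
      have r: "?r \<in> pos_def_normalized"
        by (rule pos_def_normalize[OF pd2]) (use 3 in \<open>auto simp: D0 \<phi>0\<close>)
      have t: "0 < t" "t < 1" using 3 by (auto simp: t_def)
      have tt: "(1 - t) * (1 / (2 + 2 * d)) = 1 / 4" "t * (1 / (2 - 2 * d)) = 1 / 4"
        using 3 by (auto simp: t_def field_simps)
      have "\<phi> = (\<lambda>x. (1 - t) *\<^sub>R ?q x + t *\<^sub>R ?r x)"
        unfolding scaleR_scaleR tt by (rule ext) (simp add: quat_eq_iff field_simps)
      then have "?q = \<phi>"
        using extreme_inD[OF extr q r t] by simp
      then have "(2 + 2 * d) *\<^sub>R \<phi> x = (2 + 2 * d) *\<^sub>R ?q x"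
        by (rule arg_cong[OF fun_cong[OF sym]])
      also have "\<dots> = 2 *\<^sub>R \<phi> x + D x" using 3 by simp
      finally have "2 *\<^sub>R \<phi> x + D x = (2 + 2 * d) *\<^sub>R \<phi> x" ..
      then show ?thesis by (simp add: scaleR_add_left)
    qed
  qed
  then show ?thesis by (simp add: D_def d_def)
qed

text \<open>Write \<open>R\<close> and \<open>V\<close> for the real and imaginary parts of \<phi>.
  The equation for \<open>c = 1\<close> yields a sine-type addition formula for \<open>V\<close>,
  and associativity of the group operation applied to it forces all values of \<open>V\<close> onto
  one line. A unit vector \<open>u\<close> on that line then commutes with every value of
  \<phi>.\<close>

lemma extreme_pos_def_commutant:
  fixes \<phi> :: "'g::ab_group_add \<Rightarrow> quat"
  assumes ext: "extreme_in pos_def_normalized \<phi>"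
  obtains u where "norm u = 1" "u $ 1 = 0" "\<And>x. qmul u (\<phi> x) = qmul (\<phi> x) u"
    "\<And>x. \<exists>s. \<phi> x = axis 1 (\<phi> x $ 1) + s *\<^sub>R u"
proof -
  have pd: "pos_def \<phi>" and \<phi>0: "\<phi> 0 = axis 1 1"
    using extreme_in_mem[OF ext] by (simp_all add: pos_def_normalized_def)
  define R where "R x = \<phi> x $ 1" for x
  define V where "V x = \<phi> x - axis 1 (R x)" for x
  have sum: "\<phi> (x + a) + \<phi> (x - a) = (2 * R a) *\<^sub>R \<phi> x" for x a
    using extreme_translate[OF ext, of "axis 1 1" x a] by (simp add: R_def)
  have Rm: "R (- x) = R x" and Vm: "V (- x) = - V x" for x
    by (simp_all add: pos_def_uminus[OF pd] R_def V_def quat_eq_iff)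
  have R: "R (x + a) + R (x - a) = 2 * R a * R x" for x a
    using arg_cong[OF sum[of x a], of "\<lambda>v. v $ 1"] by (simp add: R_def)
  have Vsum: "V (x + a) + V (x - a) = (2 * R a) *\<^sub>R V x" for x a
    using sum[of x a] R[of x a] by (simp add: V_def quat_eq_iff algebra_simps)
  \<comment> \<open>Add the equation to the one with \<open>x\<close> and \<open>a\<close>
    exchanged; since \<open>V\<close> is odd, the terms at \<open>x - a\<close> and
    \<open>a - x\<close> cancel.\<close>
  have V: "V (x + a) = R a *\<^sub>R V x + R x *\<^sub>R V a" for x a
  proof -
    have "V (a - x) = - V (x - a)" using Vm[of "x - a"] by simp
    then show ?thesis
      using Vsum[of x a] Vsum[of a x] by (simp add: quat_eq_iff add.commute)
  qed
  \<comment> \<open>In the model case where \<open>R\<close> is a cosine, \<open>C y z\<close> is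
    the product of the two sines. It is the coefficient left over when \<open>V (x + y + z)\<close>
    is expanded in two ways.\<close>
  define C where "C y z = R y * R z - R (y + z)" for y z
  have CV: "C y z *\<^sub>R V x = C x y *\<^sub>R V z" for x y z
  proof -
    have "V (x + (y + z)) = V ((x + y) + z)" by (simp add: add.assoc)
    then show ?thesis
      unfolding V C_def by (simp add: quat_eq_iff algebra_simps)
  qed
  have "\<exists>u::quat. norm u = 1 \<and> u $ 1 = 0 \<and> (\<forall>x. \<exists>s. V x = s *\<^sub>R u)"
  proof (cases "\<forall>x. V x = 0")
    \<comment> \<open>Here \<phi> is real-valued and any imaginary unit serves;
      \<open>axis 2 1\<close> is \<open>i\<close>.\<close>
    case True
    have "axis (2::4) 1 $ 1 = (0::real)" by (simp add: axis_def)
    then show ?thesis using True by (intro exI[of _ "axis 2 1"]) (auto intro: exI[of _ 0])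
  next
    case False
    then obtain w where w: "V w \<noteq> 0" by blast
    \<comment> \<open>Otherwise \<open>C w (- w) = 0\<close> together with \<open>R 0 = 1\<close>
      and evenness of \<open>R\<close> gives \<open>(R w)^2 = 1\<close>, and
      \<open>|\<phi>(w)| \<le> 1\<close> leaves no room for a nonzero \<open>V w\<close>.\<close>
    have "\<exists>y z. C y z \<noteq> 0"
    proof (rule ccontr)
      assume "\<not> ?thesis"
      then have "R w * R (- w) = R 0" unfolding C_def by (metis add.right_inverse right_minus_eq)
      then have "(R w)\<^sup>2 = 1" by (simp add: Rm power2_eq_square) (simp add: R_def \<phi>0)
      moreover have "norm (\<phi> w) \<le> 1" using norm_pos_def_le[OF pd, of w] by (simp add: \<phi>0)
      then have "(norm (\<phi> w))\<^sup>2 \<le> 1" by (simp add: power_le_one)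
      ultimately have "(\<phi> w $ 2)\<^sup>2 + (\<phi> w $ 3)\<^sup>2 + (\<phi> w $ 4)\<^sup>2 \<le> 0"
        by (simp add: norm_quat R_def)
      then have "(\<phi> w $ 2)\<^sup>2 = 0 \<and> (\<phi> w $ 3)\<^sup>2 = 0 \<and> (\<phi> w $ 4)\<^sup>2 = 0"
        by (smt (verit) zero_le_power2)
      then have "V w = 0"
        by (simp add: V_def R_def quat_eq_iff)
      then show False using w by simp
    qed
    then obtain y z where yz: "C y z \<noteq> 0" by blast
    have Vx: "V x = (C x y / C y z) *\<^sub>R V z" for x
    proof -
      have "(1 / C y z) *\<^sub>R (C y z *\<^sub>R V x) = (1 / C y z) *\<^sub>R (C x y *\<^sub>R V z)" using CV by simp
      then show ?thesis using yz by simp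
    qed
    have "V z \<noteq> 0" using Vx[of w] w by auto
    have "V z $ 1 = 0" by (simp add: V_def R_def)
    then have "sgn (V z) $ 1 = 0" by (simp add: sgn_div_norm)
    moreover have "norm (sgn (V z)) = 1" using \<open>V z \<noteq> 0\<close> by (simp add: norm_sgn)
    moreover have "\<exists>s. V x = s *\<^sub>R sgn (V z)" for x
      using Vx[of x] \<open>V z \<noteq> 0\<close>
      by (intro exI[of _ "C x y / C y z * norm (V z)"]) (simp add: sgn_div_norm)
    ultimately show ?thesis by blast
  qed
  then obtain u where u: "norm u = 1" "u $ 1 = 0" "\<And>x. \<exists>s. V x = s *\<^sub>R u" by blast
  have dec: "\<exists>s. \<phi> x = axis 1 (\<phi> x $ 1) + s *\<^sub>R u" for x
    using u(3)[of x] by (auto simp: V_def R_def algebra_simps)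
  have "qmul u (\<phi> x) = qmul (\<phi> x) u" for x
  proof -
    obtain s where "\<phi> x = axis 1 (\<phi> x $ 1) + s *\<^sub>R u" using dec by blast
    then obtain r where "\<phi> x = axis 1 r + s *\<^sub>R u" by blast
    then show ?thesis
      by (simp add: qmul.add_left qmul.add_right qmul.scaleR_left qmul.scaleR_right)
  qed
  then show ?thesis using that u dec by blast
qed

text \<open>The equations for \<open>c = 1\<close> and \<open>c = u\<close> determine the sum and
  the difference of \<open>\<phi>(x + a)\<close> and \<open>\<phi>(x - a)\<close>; adding them gives
  multiplicativity. Values have norm 1 because \<open>\<phi>(a) \<phi>(-a) = \<phi>(0)\<close> and
  \<phi>(-a) is the conjugate of \<phi>(a).\<close>

lemma extreme_pos_def_in_qdual:
  fixes \<phi> :: "'g::ab_group_add \<Rightarrow> quat"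
  assumes ext: "extreme_in pos_def_normalized \<phi>"
  shows "\<phi> \<in> qdual"
proof -
  have pd: "pos_def \<phi>" and \<phi>0: "\<phi> 0 = axis 1 1"
    using extreme_in_mem[OF ext] by (simp_all add: pos_def_normalized_def)
  obtain u where u: "norm u = 1" "u $ 1 = 0" and comm: "\<And>x. qmul u (\<phi> x) = qmul (\<phi> x) u"
    and dec: "\<And>x. \<exists>s. \<phi> x = axis 1 (\<phi> x $ 1) + s *\<^sub>R u"
    using extreme_pos_def_commutant[OF ext] by blast
  have cu: "qcnj u = - u" using u by (simp add: quat_eq_iff)
  have uu: "qmul u u = axis 1 (- 1)"
    using qmul_qcnj(1)[of u] u(1) by (simp add: cu qmul.minus_left quat_eq_iff)
  have mult: "\<phi> (x + a) = qmul (\<phi> a) (\<phi> x)" for x a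
  proof -
    obtain s where "\<phi> a = axis 1 (\<phi> a $ 1) + s *\<^sub>R u" using dec by blast
    then obtain r where \<phi>a: "\<phi> a = axis 1 r + s *\<^sub>R u" and r: "\<phi> a $ 1 = r" by blast
    have 1: "\<phi> (x + a) + \<phi> (x - a) = (2 * r) *\<^sub>R \<phi> x"
      using extreme_translate[OF ext, of "axis 1 1" x a] by (simp add: r)
    have "qmul (\<phi> a) u $ 1 = - s"
      by (simp add: \<phi>a qmul.add_left qmul.scaleR_left uu u(2) del: qmul_nth)
    then have "qmul u (\<phi> (x + a)) - qmul u (\<phi> (x - a)) = (2 * - s) *\<^sub>R \<phi> x"
      using extreme_translate[OF ext u(1) comm, of x a] by (simp add: cu comm qmul.minus_left)
    \<comment> \<open>A second multiplication by \<open>u\<close> uses \<open>u u = -1\<close> to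
      isolate the difference on the left.\<close>
    then have "qmul u (qmul u (\<phi> (x + a) - \<phi> (x - a))) = qmul u ((2 * - s) *\<^sub>R \<phi> x)"
      by (simp add: qmul.diff_right)
    then have "- (\<phi> (x + a) - \<phi> (x - a)) = - ((2 * s) *\<^sub>R qmul u (\<phi> x))"
      by (simp add: uu qmul.scaleR_right qmul.minus_right flip: qmul_assoc)
    then have 2: "\<phi> (x + a) - \<phi> (x - a) = (2 * s) *\<^sub>R qmul u (\<phi> x)"
      by (simp only: neg_equal_iff_equal)
    have "2 *\<^sub>R \<phi> (x + a) = (\<phi> (x + a) + \<phi> (x - a)) + (\<phi> (x + a) - \<phi> (x - a))"
      by (simp add: scaleR_2)
    also have "\<dots> = 2 *\<^sub>R qmul (\<phi> a) (\<phi> x)"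
      unfolding 1 2 by (simp add: \<phi>a qmul.add_left qmul.scaleR_left scaleR_add_right)
    finally have "2 *\<^sub>R \<phi> (x + a) = 2 *\<^sub>R qmul (\<phi> a) (\<phi> x)" .
    then show ?thesis by simp
  qed
  have "norm (\<phi> a) = 1" for a
  proof -
    have "qmul (\<phi> a) (qcnj (\<phi> a)) = axis 1 1"
      using mult[of "- a" a] by (simp add: \<phi>0 pos_def_uminus[OF pd])
    then have "(norm (\<phi> a))\<^sup>2 = 1"
      by (metis qmul_qcnj(2) axis_1_nth(1))
    then show ?thesis by (simp add: power2_eq_1_iff) (smt (verit) norm_ge_zero)
  qed
  moreover have "\<phi> (a + b) = qmul (\<phi> a) (\<phi> b)" for a b
    using mult[of b a] by (simp add: add.commute)
  ultimately show ?thesis by (simp add: qdual_def)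
qed

section \<open>Extreme points of compact sets of functions\<close>

text \<open>The extreme sets of the Krein-Milman argument; \<open>closed\<close> refers to the
  topology of pointwise convergence.\<close>

definition face_of_functions :: "('a \<Rightarrow> 'b::euclidean_space) set \<Rightarrow> ('a \<Rightarrow> 'b) set \<Rightarrow> bool" where
  "face_of_functions K S \<longleftrightarrow> S \<subseteq> K \<and> closed S \<and> S \<noteq> {} \<and>
    (\<forall>q\<in>K. \<forall>r\<in>K. \<forall>t. 0 < t \<and> t < 1 \<and> (\<lambda>x. (1 - t) *\<^sub>R q x + t *\<^sub>R r x) \<in> S \<longrightarrow> q \<in> S \<and> r \<in> S)"

lemma face_of_functionsD:
  assumes "face_of_functions K S" "q \<in> K" "r \<in> K" "0 < t" "t < 1"
    and "(\<lambda>x. (1 - t) *\<^sub>R q x + t *\<^sub>R r x) \<in> S"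
  shows "q \<in> S \<and> r \<in> S"
proof -
  have "\<forall>t. 0 < t \<and> t < 1 \<and> (\<lambda>x. (1 - t) *\<^sub>R q x + t *\<^sub>R r x) \<in> S \<longrightarrow> q \<in> S \<and> r \<in> S"
    using assms(1-3) unfolding face_of_functions_def by blast
  from spec[OF this, of t] show ?thesis using assms(4-6) by (elim mp) (intro conjI)
qed

text \<open>Compactness provides a maximum of \<open>l\<close> on \<open>S\<close>. A proper convex
  combination of two points of \<open>S\<close> can reach it only if both points do.\<close>

lemma face_argmax:
  fixes K :: "('a \<Rightarrow> 'b::euclidean_space) set" and l :: "('a \<Rightarrow> 'b) \<Rightarrow> real"
  assumes K: "compact K" and S: "face_of_functions K S" and l: "continuous_on UNIV l"
    and affine: "\<And>p q t. l (\<lambda>x. (1 - t) *\<^sub>R p x + t *\<^sub>R q x) = (1 - t) * l p + t * l q"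
  shows "face_of_functions K {p \<in> S. \<forall>q\<in>S. l q \<le> l p}"
proof -
  have S': "S \<subseteq> K" "closed S" "S \<noteq> {}"
    and face: "\<And>q r t. q \<in> K \<Longrightarrow> r \<in> K \<Longrightarrow> 0 < t \<Longrightarrow> t < 1 \<Longrightarrow>
      (\<lambda>x. (1 - t) *\<^sub>R q x + t *\<^sub>R r x) \<in> S \<Longrightarrow> q \<in> S \<and> r \<in> S"
    using S face_of_functionsD[OF S] unfolding face_of_functions_def by blast+
  have "compact S" using S' K by (metis compact_Int_closed inf.absorb2)
  then obtain m where m: "m \<in> S" "\<And>q. q \<in> S \<Longrightarrow> l q \<le> l m"
    using continuous_attains_sup[OF _ S'(3), of l] continuous_on_subset[OF l] by blast
  have eq: "{p \<in> S. \<forall>q\<in>S. l q \<le> l p} = S \<inter> {p. l m \<le> l p}"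
    using m by (auto intro: order_trans)
  have "closed (S \<inter> {p. l m \<le> l p})"
    using S'(2) l by (intro closed_Int closed_Collect_le) auto
  moreover have "q \<in> S \<inter> {p. l m \<le> l p} \<and> r \<in> S \<inter> {p. l m \<le> l p}"
    if "q \<in> K" "r \<in> K" "0 < t" "t < 1" "(\<lambda>x. (1 - t) *\<^sub>R q x + t *\<^sub>R r x) \<in> S \<inter> {p. l m \<le> l p}" for q r t
  proof -
    have qr: "q \<in> S" "r \<in> S" using face[OF that(1-4)] that(5) by auto
    have le: "l m \<le> (1 - t) * l q + t * l r" using that(5) by (simp add: affine)
    have "l m \<le> l q"
    proof (rule ccontr)
      assume "\<not> ?thesis"
      then have "(1 - t) * l q < (1 - t) * l m" using that(4) by simp
      moreover have "t * l r \<le> t * l m" using m(2)[OF qr(2)] that(3) by simp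
      ultimately show False using le by (simp add: algebra_simps)
    qed
    moreover have "l m \<le> l r"
    proof (rule ccontr)
      assume "\<not> ?thesis"
      then have "t * l r < t * l m" using that(3) by simp
      moreover have "(1 - t) * l q \<le> (1 - t) * l m" using m(2)[OF qr(1)] that(4) by simp
      ultimately show False using le by (simp add: algebra_simps)
    qed
    ultimately show ?thesis using qr by simp
  qed
  ultimately show ?thesis
    unfolding eq face_of_functions_def using S'(1) m(1) by blast
qed

lemma chain_finite_subset_has_least:
  assumes "finite \<F>" "\<F> \<noteq> {}" "\<And>A B. A \<in> \<F> \<Longrightarrow> B \<in> \<F> \<Longrightarrow> A \<subseteq> B \<or> B \<subseteq> A"
  shows "\<Inter>\<F> \<in> \<F>"
  using assms
proof (induction \<F> rule: finite_ne_induct)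
  case (insert A \<F>)
  then have "\<Inter>\<F> \<in> \<F>" by blast
  then have "A \<subseteq> \<Inter>\<F> \<or> \<Inter>\<F> \<subseteq> A" using insert.prems by blast
  then show ?case using \<open>\<Inter>\<F> \<in> \<F>\<close> by (auto simp: Int_absorb1 Int_absorb2)
qed simp

text \<open>The critical point is nonemptiness: a finite subfamily of a chain contains its own
  intersection, which is a nonempty face, so compactness yields a common point.\<close>

lemma face_chain_Inter:
  assumes K: "compact K" and ne: "\<C> \<noteq> {}" and face: "\<And>S. S \<in> \<C> \<Longrightarrow> face_of_functions K S"
    and chain: "\<And>A B. A \<in> \<C> \<Longrightarrow> B \<in> \<C> \<Longrightarrow> A \<subseteq> B \<or> B \<subseteq> A"
  shows "face_of_functions K (\<Inter>\<C>)"
proof -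
  have "K \<inter> \<Inter>\<C> \<noteq> {}"
  proof (rule compact_imp_fip[OF K])
    show "closed S" if "S \<in> \<C>" for S using face[OF that] by (simp add: face_of_functions_def)
    fix \<F> assume F: "finite \<F>" "\<F> \<subseteq> \<C>"
    show "K \<inter> \<Inter>\<F> \<noteq> {}"
    proof (cases "\<F> = {}")
      case True
      obtain S where "S \<in> \<C>" using ne by blast
      from face[OF this] have "S \<subseteq> K" "S \<noteq> {}" by (simp_all add: face_of_functions_def)
      then show ?thesis using True by auto
    next
      case False
      have "\<Inter>\<F> \<in> \<F>" using chain F(2) by (intro chain_finite_subset_has_least[OF F(1) False]) blast
      then have "face_of_functions K (\<Inter>\<F>)" using face F by blast
      then have "\<Inter>\<F> \<subseteq> K" "\<Inter>\<F> \<noteq> {}" by (simp_all add: face_of_functions_def)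
      then show ?thesis by auto
    qed
  qed
  moreover have "\<Inter>\<C> \<subseteq> K"
    using ne face unfolding face_of_functions_def by blast
  moreover have "closed (\<Inter>\<C>)"
    using face by (intro closed_Inter) (simp add: face_of_functions_def)
  moreover have "q \<in> \<Inter>\<C> \<and> r \<in> \<Inter>\<C>"
    if qrt: "q \<in> K" "r \<in> K" "0 < t" "t < 1" "(\<lambda>x. (1 - t) *\<^sub>R q x + t *\<^sub>R r x) \<in> \<Inter>\<C>" for q r t
  proof -
    have "q \<in> S \<and> r \<in> S" if S: "S \<in> \<C>" for S
      by (rule face_of_functionsD[OF face[OF S] qrt(1-4) InterD[OF qrt(5) S]])
    then show ?thesis by blast
  qed
  ultimately show ?thesis
    unfolding face_of_functions_def by blast
qed

lemma minimal_face:
  assumes K: "compact K" and S0: "face_of_functions K S\<^sub>0"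
  obtains S where "face_of_functions K S" "S \<subseteq> S\<^sub>0" "\<And>R. face_of_functions K R \<Longrightarrow> R \<subseteq> S \<Longrightarrow> R = S"
proof -
  \<comment> \<open>Passing to complements turns minimal faces into maximal elements, the form in
    which Zorn's lemma is applied.\<close>
  define \<A> where "\<A> = {- S | S. face_of_functions K S \<and> S \<subseteq> S\<^sub>0}"
  have "\<exists>M\<in>\<A>. \<forall>Y\<in>\<A>. M \<subseteq> Y \<longrightarrow> Y = M"
  proof (rule subset_Zorn_nonempty)
    show "\<A> \<noteq> {}" using S0 by (auto simp: \<A>_def)
    fix \<C> assume ne: "\<C> \<noteq> {}" and "subset.chain \<A> \<C>"
    then have sub: "\<C> \<subseteq> \<A>" and chain: "\<And>A B. A \<in> \<C> \<Longrightarrow> B \<in> \<C> \<Longrightarrow> A \<subseteq> B \<or> B \<subseteq> A"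
      by (auto simp: subset_chain_def)
    have "face_of_functions K (\<Inter>(uminus ` \<C>))"
    proof (rule face_chain_Inter[OF K])
      show "face_of_functions K S" if "S \<in> uminus ` \<C>" for S
        using that sub by (auto simp: \<A>_def)
      show "A \<subseteq> B \<or> B \<subseteq> A" if "A \<in> uminus ` \<C>" "B \<in> uminus ` \<C>" for A B
        using that chain by auto
    qed (use ne in simp)
    moreover have "\<Inter>(uminus ` \<C>) \<subseteq> S\<^sub>0"
      using ne sub by (auto simp: \<A>_def)
    moreover have "\<Union>\<C> = - \<Inter>(uminus ` \<C>)" by auto
    ultimately show "\<Union>\<C> \<in> \<A>" unfolding \<A>_def by blast
  qed
  then obtain S where S: "face_of_functions K S" "S \<subseteq> S\<^sub>0" and max: "\<And>Y. Y \<in> \<A> \<Longrightarrow> - S \<subseteq> Y \<Longrightarrow> Y = - S"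
    by (auto simp: \<A>_def)
  have "R = S" if "face_of_functions K R" "R \<subseteq> S" for R
  proof -
    have "- R \<in> \<A>" using that S(2) by (auto simp: \<A>_def)
    then show ?thesis using max[of "- R"] that by auto
  qed
  then show ?thesis by (rule that[OF S])
qed

text \<open>Take a minimal face inside the set of maximizers of \<open>l\<close>. Each coordinate
  functional attains its maximum over this face on a subface, which by minimality is the whole face,
  so it is constant there. Coordinates separate points; hence the face is a single point, and that
  point is extreme.\<close>

theorem extreme_point_maximizes:
  fixes K :: "('a \<Rightarrow> 'b::euclidean_space) set" and l :: "('a \<Rightarrow> 'b) \<Rightarrow> real"
  assumes K: "compact K" "closed K" "K \<noteq> {}" and l: "continuous_on UNIV l"
    and affine: "\<And>p q t. l (\<lambda>x. (1 - t) *\<^sub>R p x + t *\<^sub>R q x) = (1 - t) * l p + t * l q"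
  obtains p where "extreme_in K p" "\<And>q. q \<in> K \<Longrightarrow> l q \<le> l p"
proof -
  have "face_of_functions K K" using K by (simp add: face_of_functions_def)
  then have "face_of_functions K {p \<in> K. \<forall>q\<in>K. l q \<le> l p}"
    by (rule face_argmax[OF K(1) _ l affine])
  then obtain S where S: "face_of_functions K S" and sub: "S \<subseteq> {p \<in> K. \<forall>q\<in>K. l q \<le> l p}"
    and min: "\<And>R. face_of_functions K R \<Longrightarrow> R \<subseteq> S \<Longrightarrow> R = S"
    by (rule minimal_face[OF K(1)]) blast
  obtain p where p: "p \<in> S" using S unfolding face_of_functions_def by blast
  have single: "q = p" if q: "q \<in> S" for q
  proof
    fix x
    have "q x \<bullet> b = p x \<bullet> b" for b
    proof -
      have "face_of_functions K {p \<in> S. \<forall>q\<in>S. q x \<bullet> b \<le> p x \<bullet> b}"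
        by (rule face_argmax[OF K(1) S]) (auto intro!: continuous_intros simp: inner_add_left)
      then have eq: "{p \<in> S. \<forall>q\<in>S. q x \<bullet> b \<le> p x \<bullet> b} = S" by (rule min) auto
      have "p x \<bullet> b \<le> q x \<bullet> b" "q x \<bullet> b \<le> p x \<bullet> b"
        using p q eq by blast+
      then show ?thesis by (rule antisym[rotated])
    qed
    then show "q x = p x" by (rule euclidean_eqI)
  qed
  have "extreme_in K p"
    unfolding extreme_in_def
  proof (intro conjI ballI allI impI)
    show "p \<in> K" using sub p by blast
    fix q r t assume qr: "q \<in> K" "r \<in> K" and t: "0 < t \<and> t < 1 \<and> p = (\<lambda>x. (1 - t) *\<^sub>R q x + t *\<^sub>R r x)"
    then have "(\<lambda>x. (1 - t) *\<^sub>R q x + t *\<^sub>R r x) \<in> S" using p by simp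
    with t have "q \<in> S" by (intro face_of_functionsD[OF S qr, THEN conjunct1]) auto
    then show "q = p" by (rule single)
  qed
  moreover have "l q \<le> l p" if "q \<in> K" for q using sub p that by blast
  ultimately show ?thesis by (rule that)
qed

section \<open>Radon measures from positive functionals\<close>

text \<open>The laws are imposed on all functions bounded on \<open>X\<close>, continuous or not, so
  that \<open>L\<close> can be applied to the indicator of an arbitrary set.\<close>

locale positive_functional =
  fixes X :: "'a set" and L :: "('a \<Rightarrow> real) \<Rightarrow> real"
  assumes add: "\<And>f g. bounded (f ` X) \<Longrightarrow> bounded (g ` X) \<Longrightarrow> L (\<lambda>x. f x + g x) = L f + L g"
    and scale: "\<And>c f. bounded (f ` X) \<Longrightarrow> L (\<lambda>x. c * f x) = c * L f"
    and nonneg: "\<And>f. bounded (f ` X) \<Longrightarrow> (\<And>x. x \<in> X \<Longrightarrow> 0 \<le> f x) \<Longrightarrow> 0 \<le> L f"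
begin

section \<open>Elementary properties of positive functionals\<close>

lemma bounded_const_image: "bounded ((\<lambda>_. c::real) ` X)"
  by (rule boundedI[of _ "\<bar>c\<bar>"]) auto

lemma bounded_indicator_image: "bounded (indicat_real A ` X)"
  by (rule boundedI[of _ 1]) (auto simp: indicator_def)

lemma bounded_add_image:
  "bounded (f ` X) \<Longrightarrow> bounded (g ` X) \<Longrightarrow> bounded ((\<lambda>x. f x + g x :: real) ` X)"
  by (rule bounded_plus_comp)

lemma bounded_scale_image: "bounded (f ` X) \<Longrightarrow> bounded ((\<lambda>x. c * f x :: real) ` X)"
  using bounded_scaling[of "f ` X" c] by (simp add: image_image)

lemma zero: "L (\<lambda>_. 0) = 0"
  using scale[of "\<lambda>_. 0" 0] bounded_const_image by simp

lemma diff: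
  assumes "bounded (f ` X)" "bounded (g ` X)"
  shows "L (\<lambda>x. f x - g x) = L f - L g"
  using add[OF assms(1) bounded_scale_image[OF assms(2), of "-1"]] scale[OF assms(2), of "-1"] by simp

lemma bounded_diff_image:
  "bounded (f ` X) \<Longrightarrow> bounded (g ` X) \<Longrightarrow> bounded ((\<lambda>x. f x - g x :: real) ` X)"
  by (rule bounded_minus_comp)

lemma mono:
  assumes "bounded (f ` X)" "bounded (g ` X)" "\<And>x. x \<in> X \<Longrightarrow> f x \<le> g x"
  shows "L f \<le> L g"
  using nonneg[OF bounded_diff_image[OF assms(2,1)]] diff[OF assms(2,1)] assms(3) by fastforce

lemma cong:
  assumes "bounded (f ` X)" "\<And>x. x \<in> X \<Longrightarrow> f x = g x"
  shows "L f = L g"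
proof -
  have "bounded (g ` X)" using assms by (metis (no_types, lifting) image_cong)
  then show ?thesis using mono[of f g] mono[of g f] assms by (intro antisym) auto
qed

lemma bounded_sum_image:
  fixes f :: "'i \<Rightarrow> 'a \<Rightarrow> real"
  assumes "\<And>i. i \<in> I \<Longrightarrow> bounded (f i ` X)"
  shows "bounded ((\<lambda>x. \<Sum>i\<in>I. f i x) ` X)"
  using assms
proof (induction I rule: infinite_finite_induct)
  case (insert i I)
  then show ?case using bounded_add_image[of "f i" "\<lambda>x. \<Sum>i\<in>I. f i x"] by simp
qed (use bounded_const_image[of 0] in simp_all)

lemma sum:
  assumes "finite I" "\<And>i. i \<in> I \<Longrightarrow> bounded (f i ` X)"
  shows "L (\<lambda>x. \<Sum>i\<in>I. f i x) = (\<Sum>i\<in>I. L (f i))"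
  using assms
proof (induction I rule: finite_induct)
  case (insert i I)
  then show ?case using add[of "f i" "\<lambda>x. \<Sum>i\<in>I. f i x"] by (simp add: bounded_sum_image)
qed (simp add: zero)

lemma abs_le:
  assumes "\<And>x. x \<in> X \<Longrightarrow> \<bar>f x\<bar> \<le> b"
  shows "\<bar>L f\<bar> \<le> b * L (\<lambda>_. 1)"
proof -
  have f: "bounded (f ` X)" by (rule boundedI[of _ b]) (use assms in auto)
  have b: "L (\<lambda>_. c) = c * L (\<lambda>_. 1)" for c
    using scale[OF bounded_const_image, of c 1] by simp
  have "L f \<le> L (\<lambda>_. b)" "L (\<lambda>_. - b) \<le> L f"
    using assms by (auto intro!: mono f bounded_const_image simp: abs_le_iff) (smt (verit) assms)
  then show ?thesis unfolding b[of b] b[of "-b"] by simp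
qed

text \<open>A finitely additive set function on all sets; countable additivity is obtained only for
  the measure built from it.\<close>

definition mass :: "'a set \<Rightarrow> real" where
  "mass A = L (indicat_real A)"

lemma mass_nonneg: "0 \<le> mass A"
  unfolding mass_def by (rule nonneg[OF bounded_indicator_image]) simp

lemma mass_mono: "A \<subseteq> B \<Longrightarrow> mass A \<le> mass B"
  unfolding mass_def by (intro mono bounded_indicator_image) (auto simp: indicator_def)

lemma mass_Un_le: "mass (A \<union> B) \<le> mass A + mass B"
  unfolding mass_def add[OF bounded_indicator_image bounded_indicator_image, symmetric]
  by (intro mono bounded_indicator_image bounded_add_image) (auto simp: indicator_def)

lemma mass_Un_disjoint: "A \<inter> B = {} \<Longrightarrow> mass (A \<union> B) = mass A + mass B"
  unfolding mass_def add[OF bounded_indicator_image bounded_indicator_image, symmetric]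
  by (intro cong bounded_indicator_image) (auto simp: indicator_def)

lemma mass_empty: "mass {} = 0"
  using zero by (simp add: mass_def indicator_def[abs_def])

lemma mass_space: "mass X = L (\<lambda>_. 1)"
  unfolding mass_def by (intro cong bounded_indicator_image) simp

end

section \<open>The regularized outer measure on a compact Hausdorff space\<close>

locale compact_positive_functional =
  positive_functional "topspace T" L for T :: "'a topology" and L +
  assumes compact: "compact_space T" and Hausdorff: "Hausdorff_space T"
begin

text \<open>Inner regularization of \<open>mass\<close>: approximation by closed, hence compact,
  sets turns finite subadditivity into countable subadditivity on open sets.\<close>

definition open_content :: "'a set \<Rightarrow> ennreal" where
  "open_content U = (SUP C\<in>{C. closedin T C \<and> C \<subseteq> U}. ennreal (mass C))"

definition outer :: "'a set \<Rightarrow> ennreal" where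
  "outer A = (INF U\<in>{U. openin T U \<and> A \<subseteq> U}. open_content U)"

lemma mass_le_open_content: "closedin T C \<Longrightarrow> C \<subseteq> U \<Longrightarrow> ennreal (mass C) \<le> open_content U"
  unfolding open_content_def by (rule SUP_upper) simp

lemma open_content_leI:
  "(\<And>C. closedin T C \<Longrightarrow> C \<subseteq> U \<Longrightarrow> ennreal (mass C) \<le> r) \<Longrightarrow> open_content U \<le> r"
  unfolding open_content_def by (rule SUP_least) simp

lemma open_content_le_content: "open_content U \<le> ennreal (mass U)"
  by (intro open_content_leI ennreal_leI mass_mono)

lemma open_content_mono: "U \<subseteq> V \<Longrightarrow> open_content U \<le> open_content V"
  by (intro open_content_leI mass_le_open_content) auto

text \<open>For closed \<open>C\<close> inside the union, normality separates \<open>C - U\<close>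
  and \<open>C - V\<close> by disjoint open sets \<open>A\<close> and \<open>B\<close>. Then
  \<open>C\<close> is the union of the closed sets \<open>C - A\<close> and \<open>C - B\<close>,
  which lie in \<open>U\<close> and \<open>V\<close> respectively.\<close>

lemma open_content_Un:
  assumes U: "openin T U" and V: "openin T V"
  shows "open_content (U \<union> V) \<le> open_content U + open_content V"
proof (rule open_content_leI)
  fix C assume C: "closedin T C" "C \<subseteq> U \<union> V"
  have "normal_space T"
    using compact Hausdorff compact_Hausdorff_or_regular_imp_normal_space by blast
  moreover have "closedin T (C - U)" "closedin T (C - V)" "disjnt (C - U) (C - V)"
    using C U V by (auto simp: disjnt_def)
  ultimately obtain A B where AB: "openin T A" "openin T B" "C - U \<subseteq> A" "C - V \<subseteq> B" "disjnt A B"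
    unfolding normal_space_def by metis
  have "mass C \<le> mass (C - A) + mass (C - B)"
    using mass_Un_le[of "C - A" "C - B"] AB(5)
    by (metis Diff_Int Diff_empty disjnt_def)
  then have "ennreal (mass C) \<le> ennreal (mass (C - A)) + ennreal (mass (C - B))"
    by (metis mass_nonneg ennreal_leI ennreal_plus)
  also have "\<dots> \<le> open_content U + open_content V"
    using AB C by (intro add_mono mass_le_open_content) auto
  finally show "ennreal (mass C) \<le> open_content U + open_content V" .
qed

lemma open_content_empty: "open_content {} = 0"
  using open_content_le_content[of "{}"] by (simp add: mass_empty)

lemma open_content_finite_UN:
  assumes "finite I" "\<And>i. i \<in> I \<Longrightarrow> openin T (U i)"
  shows "open_content (\<Union>i\<in>I. U i) \<le> (\<Sum>i\<in>I. open_content (U i))"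
  using assms
proof (induction I rule: finite_induct)
  case (insert i I)
  have "open_content (\<Union>i\<in>insert i I. U i) \<le> open_content (U i) + open_content (\<Union>i\<in>I. U i)"
    using insert.prems open_content_Un[of "U i" "\<Union>i\<in>I. U i"] by auto
  also have "\<dots> \<le> open_content (U i) + (\<Sum>i\<in>I. open_content (U i))"
    using insert by (intro add_left_mono) auto
  finally show ?case using insert.hyps by simp
qed (simp add: open_content_empty)

text \<open>A closed subset of the union is compact, hence covered by finitely many of the open
  sets.\<close>

lemma open_content_UN:
  fixes U :: "nat \<Rightarrow> 'a set"
  assumes "\<And>i. openin T (U i)"
  shows "open_content (\<Union>i. U i) \<le> (\<Sum>i. open_content (U i))"
proof (rule open_content_leI)
  fix C assume C: "closedin T C" "C \<subseteq> (\<Union>i. U i)"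
  then have "compactin T C" using closedin_compact_space[OF compact] by blast
  then obtain \<F> where F: "finite \<F>" "\<F> \<subseteq> range U" "C \<subseteq> \<Union>\<F>"
    using compactinD[of T C "range U"] C(2) assms by blast
  then obtain I where I: "finite I" "\<F> = U ` I" by (meson finite_subset_image)
  have "ennreal (mass C) \<le> open_content (\<Union>i\<in>I. U i)"
    using C F I by (intro mass_le_open_content) auto
  also have "\<dots> \<le> (\<Sum>i\<in>I. open_content (U i))"
    using I assms by (intro open_content_finite_UN) auto
  also have "\<dots> \<le> (\<Sum>i. open_content (U i))"
    using I by (intro sum_le_suminf) auto
  finally show "ennreal (mass C) \<le> (\<Sum>i. open_content (U i))" .
qed

lemma outer_le: "openin T U \<Longrightarrow> A \<subseteq> U \<Longrightarrow> outer A \<le> open_content U"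
  unfolding outer_def by (rule INF_lower) simp

lemma outer_open: "openin T U \<Longrightarrow> outer U = open_content U"
  by (intro antisym outer_le order_refl) (auto simp: outer_def intro: INF_greatest open_content_mono)

lemma outer_mono: "A \<subseteq> B \<Longrightarrow> outer A \<le> outer B"
  unfolding outer_def by (rule INF_superset_mono) auto

lemma outer_finite: "A \<subseteq> topspace T \<Longrightarrow> outer A < top"
  using outer_le[of "topspace T" A, THEN order_trans, OF _ _ open_content_le_content]
  by (auto intro: le_less_trans)

lemma outer_UN:
  fixes A :: "nat \<Rightarrow> 'a set"
  assumes "\<And>i. A i \<subseteq> topspace T"
  shows "outer (\<Union>i. A i) \<le> (\<Sum>i. outer (A i))"
proof (rule ennreal_le_epsilon)
  fix e :: real assume e: "0 < e"
  have "\<exists>U. openin T U \<and> A i \<subseteq> U \<and> open_content U < outer (A i) + e * (1/2)^Suc i" for i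
  proof -
    have "outer (A i) < outer (A i) + e * (1/2)^Suc i"
      using outer_finite[OF assms, of i] e by (simp add: ennreal_zero_less_mult_iff less_top)
    then show ?thesis by (subst (asm) outer_def) (auto simp: INF_less_iff)
  qed
  then obtain U where U: "\<And>i. openin T (U i)" "\<And>i. A i \<subseteq> U i"
      "\<And>i. open_content (U i) < outer (A i) + e * (1/2)^Suc i" by metis
  have "outer (\<Union>i. A i) \<le> open_content (\<Union>i. U i)"
    using U(1,2) by (intro outer_le) auto
  also have "\<dots> \<le> (\<Sum>i. open_content (U i))" by (rule open_content_UN[OF U(1)])
  also have "\<dots> \<le> (\<Sum>i. outer (A i) + e * (1/2)^Suc i)"
    using U(3) by (intro suminf_le) (auto simp: less_imp_le)
  also have "\<dots> = (\<Sum>i. outer (A i)) + (\<Sum>i. ennreal e * ennreal ((1/2) ^ Suc i))"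
    using e by (subst suminf_add[symmetric])
      (auto simp del: ennreal_suminf_cmult simp add: ennreal_mult[symmetric])
  also have "\<dots> = (\<Sum>i. outer (A i)) + e"
    unfolding ennreal_suminf_cmult
    by (subst suminf_ennreal_eq[OF zero_le_power power_half_series]) auto
  finally show "outer (\<Union>i. A i) \<le> (\<Sum>i. outer (A i)) + e" .
qed

lemma outer_measure_space_outer: "outer_measure_space (Pow (topspace T)) outer"
  unfolding outer_measure_space_def
proof (intro conjI)
  show "positive (Pow (topspace T)) outer"
    by (simp add: positive_def outer_open open_content_empty)
  show "increasing (Pow (topspace T)) outer"
    by (simp add: increasing_def outer_mono)
  show "countably_subadditive (Pow (topspace T)) outer"
    unfolding countably_subadditive_def by (auto intro!: outer_UN)
qed

text \<open>This is Caratheodory's condition for open sets. Given an open \<open>U\<close> around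
  \<open>A\<close> and a closed \<open>C\<close> in \<open>U \<inter> V\<close>, the open set
  \<open>U - C\<close> contains \<open>A - V\<close>. A closed \<open>D\<close> in
  \<open>U - C\<close> is disjoint from \<open>C\<close>, so their masses add up to at most the
  content of \<open>U\<close>; suprema over \<open>D\<close> and then over \<open>C\<close> finish
  the argument.\<close>

lemma outer_split_open_le:
  assumes V: "openin T V"
  shows "outer (A \<inter> V) + outer (A - V) \<le> outer A"
  unfolding outer_def[of A]
proof (rule INF_greatest)
  fix U assume "U \<in> {U. openin T U \<and> A \<subseteq> U}"
  then have U: "openin T U" "A \<subseteq> U" by auto
  have *: "ennreal (mass C) + outer (A - V) \<le> open_content U"
    if C: "closedin T C" "C \<subseteq> U \<inter> V" for C
  proof -
    have "outer (A - V) \<le> open_content (U - C)"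
      using U C by (intro outer_le) auto
    moreover have "ennreal (mass C) + open_content (U - C) \<le> open_content U"
    proof -
      have "ennreal (mass C) + ennreal (mass D) \<le> open_content U"
        if D: "closedin T D" "D \<subseteq> U - C" for D
      proof -
        have "ennreal (mass C) + ennreal (mass D) = ennreal (mass (C \<union> D))"
          using D by (subst mass_Un_disjoint) (auto simp: mass_nonneg)
        also have "\<dots> \<le> open_content U"
          using C D by (intro mass_le_open_content) auto
        finally show ?thesis .
      qed
      \<comment> \<open>Adding a constant commutes with the supremum once the index set is known to
        be nonempty.\<close>
      moreover have "{} \<in> {D. closedin T D \<and> D \<subseteq> U - C}" by simp
      then have "{D. closedin T D \<and> D \<subseteq> U - C} \<noteq> {}" by blast
      ultimately show ?thesis
        unfolding open_content_def[of "U - C"]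
        by (subst ennreal_SUP_add_right) (auto intro!: SUP_least)
    qed
    ultimately show ?thesis by (rule order_trans[OF add_left_mono])
  qed
  have "{} \<in> {C. closedin T C \<and> C \<subseteq> U \<inter> V}" by simp
  then have "{C. closedin T C \<and> C \<subseteq> U \<inter> V} \<noteq> {}" by blast
  then have "open_content (U \<inter> V) + outer (A - V) \<le> open_content U"
    unfolding open_content_def[of "U \<inter> V"]
    by (subst ennreal_SUP_add_left[symmetric]) (auto intro!: SUP_least *)
  moreover have "outer (A \<inter> V) \<le> open_content (U \<inter> V)"
    using U V by (intro outer_le) auto
  ultimately show "outer (A \<inter> V) + outer (A - V) \<le> open_content U"
    by (rule order_trans[OF add_right_mono, rotated])
qed

lemma outer_Un_le:
  assumes "A \<subseteq> topspace T" "B \<subseteq> topspace T" "A \<inter> B = {}"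
  shows "outer (A \<union> B) \<le> outer A + outer B"
proof -
  have "subadditive (Pow (topspace T)) outer"
    using outer_measure_space_outer unfolding outer_measure_space_def
    by (intro ring_of_sets.countably_subadditive_subadditive[OF ring_of_sets_Pow]) auto
  then show ?thesis using assms by (simp add: subadditive_def)
qed

lemma openin_lambda_system:
  assumes V: "openin T V"
  shows "V \<in> lambda_system (topspace T) (Pow (topspace T)) outer"
proof -
  have "outer (A \<inter> V) + outer (A - V) = outer A" if "A \<subseteq> topspace T" for A
  proof (rule antisym[OF outer_split_open_le[OF V]])
    show "outer A \<le> outer (A \<inter> V) + outer (A - V)"
      using outer_Un_le[of "A \<inter> V" "A - V"] that by (fastforce simp: Int_Diff_Un)
  qed
  then show ?thesis
    using openin_subset[OF V] by (simp add: algebra.lambda_system_eq[OF algebra_Pow])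
qed

section \<open>The Borel measure and its regularity\<close>

definition riesz_measure :: "'a measure" where
  "riesz_measure = measure_of (topspace T) {U. openin T U} outer"

lemma space_riesz_measure: "space riesz_measure = topspace T"
  unfolding riesz_measure_def by (rule space_measure_of) (auto dest: openin_subset)

lemma sets_riesz_measure: "sets riesz_measure = sigma_sets (topspace T) {U. openin T U}"
  unfolding riesz_measure_def by (rule sets_measure_of) (auto dest: openin_subset)

lemma openin_sets_riesz_measure: "openin T U \<Longrightarrow> U \<in> sets riesz_measure"
  by (simp add: sets_riesz_measure sigma_sets.Basic)

lemma closedin_sets_riesz_measure: "closedin T C \<Longrightarrow> C \<in> sets riesz_measure"
  using sets.compl_sets[OF openin_sets_riesz_measure, of "topspace T - C"]
  by (simp add: space_riesz_measure closedin_def double_diff)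

text \<open>By Caratheodory's theorem \<open>outer\<close> is a measure on the sets that split every
  set additively. These form a sigma-algebra containing the open sets, hence all Borel sets.\<close>

lemma emeasure_riesz_measure:
  assumes "A \<in> sets riesz_measure"
  shows "emeasure riesz_measure A = outer A"
proof -
  let ?S = "lambda_system (topspace T) (Pow (topspace T)) outer"
  have ms: "measure_space (topspace T) ?S outer"
    using sigma_algebra.caratheodory_lemma[OF sigma_algebra_Pow outer_measure_space_outer] .
  then interpret S: sigma_algebra "topspace T" ?S by (simp add: measure_space_def)
  have sub: "sets riesz_measure \<subseteq> ?S"
    unfolding sets_riesz_measure by (intro S.sigma_sets_subset) (auto intro: openin_lambda_system)
  show ?thesis
  proof (rule emeasure_measure_of[OF riesz_measure_def])
    show "{U. openin T U} \<subseteq> Pow (topspace T)" by (auto dest: openin_subset)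
    show "positive (sets riesz_measure) outer"
      by (simp add: positive_def outer_open open_content_empty)
    show "countably_additive (sets riesz_measure) outer"
      using ms sub unfolding measure_space_def countably_additive_def by (meson subset_trans subset_eq)
    show "A \<in> sets riesz_measure" by fact
  qed
qed

lemma emeasure_riesz_open: "openin T U \<Longrightarrow> emeasure riesz_measure U = open_content U"
  by (simp add: emeasure_riesz_measure openin_sets_riesz_measure outer_open)

lemma finite_measure_riesz_measure: "finite_measure riesz_measure"
  by (rule finite_measureI)
    (use outer_finite[of "topspace T"] in
      \<open>auto simp: space_riesz_measure emeasure_riesz_measure openin_sets_riesz_measure\<close>)

text \<open>Outer regularity is built into \<open>outer\<close>. For an open set, the content is a
  supremum of \<open>mass C\<close> over closed \<open>C\<close>, and each \<open>mass C\<close> is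
  at most the measure of the compact set \<open>C\<close>.\<close>

lemma radon_on_riesz_measure: "radon_on T riesz_measure"
  unfolding radon_on_def
proof (intro conjI ballI allI impI)
  show "space riesz_measure = topspace T" by (rule space_riesz_measure)
  show "sets riesz_measure = sigma_sets (topspace T) {U. openin T U}" by (rule sets_riesz_measure)
  show "emeasure riesz_measure A = (INF U\<in>{U. openin T U \<and> A \<subseteq> U}. emeasure riesz_measure U)"
    if "A \<in> sets riesz_measure" for A
    unfolding emeasure_riesz_measure[OF that] outer_def
    by (intro INF_cong refl) (simp add: emeasure_riesz_open)
  fix U assume U: "openin T U"
  show "emeasure riesz_measure U = (SUP K\<in>{K. compactin T K \<and> K \<subseteq> U}. emeasure riesz_measure K)"
  proof (rule antisym)
    have "ennreal (mass C) \<le> (SUP K\<in>{K. compactin T K \<and> K \<subseteq> U}. emeasure riesz_measure K)"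
      if C: "closedin T C" "C \<subseteq> U" for C
    proof -
      have "ennreal (mass C) \<le> outer C"
        unfolding outer_def using C by (intro INF_greatest mass_le_open_content) auto
      also have "\<dots> = emeasure riesz_measure C"
        using C by (simp add: emeasure_riesz_measure closedin_sets_riesz_measure)
      also have "\<dots> \<le> (SUP K\<in>{K. compactin T K \<and> K \<subseteq> U}. emeasure riesz_measure K)"
        using C closedin_compact_space[OF compact] by (intro SUP_upper) auto
      finally show ?thesis .
    qed
    then show "emeasure riesz_measure U \<le> (SUP K\<in>{K. compactin T K \<and> K \<subseteq> U}. emeasure riesz_measure K)"
      unfolding emeasure_riesz_open[OF U] by (rule open_content_leI)
    show "(SUP K\<in>{K. compactin T K \<and> K \<subseteq> U}. emeasure riesz_measure K) \<le> emeasure riesz_measure U"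
      using U by (intro SUP_least emeasure_mono openin_sets_riesz_measure) auto
  qed
qed

text \<open>Equality may fail, because the mass of an open set can exceed that of all its closed
  subsets. The inequality suffices: it is later used for both a function and its negative, while the
  total masses agree.\<close>

lemma measure_riesz_open_le: "openin T U \<Longrightarrow> measure riesz_measure U \<le> mass U"
  using open_content_le_content[of U]
  by (simp add: measure_def emeasure_riesz_open enn2real_leI mass_nonneg)

lemma measure_riesz_space: "measure riesz_measure (topspace T) = L (\<lambda>_. 1)"
proof -
  have "open_content (topspace T) = ennreal (mass (topspace T))"
    by (intro antisym open_content_le_content mass_le_open_content) auto
  then show ?thesis
    by (simp add: measure_def emeasure_riesz_open mass_nonneg mass_space[symmetric])
qed

end

section \<open>Integration of continuous functions\<close>

lemma measurable_radon_continuous: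
  assumes "radon_on T M" "continuous_map T euclidean f"
  shows "f \<in> borel_measurable M"
proof (rule borel_measurableI)
  fix S :: "'b set" assume "open S"
  then have "openin T {x \<in> topspace T. f x \<in> S}"
    using assms(2) openin_continuous_map_preimage[of T euclidean f S] by simp
  moreover have "f -` S \<inter> space M = {x \<in> topspace T. f x \<in> S}"
    using assms(1) by (auto simp: radon_on_def)
  ultimately show "f -` S \<inter> space M \<in> sets M"
    using assms(1) by (simp add: radon_on_def sigma_sets.Basic)
qed

text \<open>The sum is the ceiling of \<open>y\<close>. It serves to approximate a function by an
  average of indicators of its superlevel sets.\<close>

lemma count_below_bounds:
  fixes y :: real
  assumes "0 \<le> y" "y \<le> real n"
  shows "y \<le> (\<Sum>k<n. if real k < y then 1 else 0)" "(\<Sum>k<n. if real k < y then 1 else 0) \<le> y + 1"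
proof -
  have "{k. k < n \<and> real k < y} = {..<nat \<lceil>y\<rceil>}"
    using assms by (auto simp: less_ceiling_iff zless_nat_eq_int_zless)
  then have eq: "(\<Sum>k<n. if real k < y then 1 else 0) = real (nat \<lceil>y\<rceil>)"
    by (simp add: sum.If_cases Int_def lessThan_def)
  show "y \<le> (\<Sum>k<n. if real k < y then 1 else 0)"
    unfolding eq using assms by linarith
  show "(\<Sum>k<n. if real k < y then 1 else 0) \<le> y + 1"
    unfolding eq using assms by linarith
qed

context compact_positive_functional
begin

text \<open>A layer-cake argument: \<open>f\<close> is approximated from above, within
  \<open>1 / n\<close>, by the average \<open>s\<close> of the indicators of \<open>n\<close>
  superlevel sets. Replacing their measures by their masses turns the integral of \<open>s\<close>
  into an upper bound \<open>L s\<close>.\<close>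

lemma integral_riesz_le:
  assumes f: "continuous_map T euclideanreal f" and f01: "\<And>x. x \<in> topspace T \<Longrightarrow> 0 \<le> f x \<and> f x \<le> 1"
  shows "(\<integral>x. f x \<partial>riesz_measure) \<le> L f"
proof -
  interpret M: finite_measure riesz_measure by (rule finite_measure_riesz_measure)
  have bf: "bounded (f ` topspace T)" by (rule boundedI[of _ 1]) (use f01 in auto)
  have int: "integrable riesz_measure f"
    using f01 measurable_radon_continuous[OF radon_on_riesz_measure f]
    by (intro M.integrable_const_bound[of _ 1] AE_I2) (auto simp: space_riesz_measure)
  have approx: "(\<integral>x. f x \<partial>riesz_measure) \<le> L f + L (\<lambda>_. 1) / real n" if n: "n > 0" for n :: nat
  proof -
    \<comment> \<open>The strict inequality makes these sets open, which is where the measure is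
      bounded by the mass.\<close>
    define U where "U k = {x \<in> topspace T. real k < real n * f x}" for k
    define s where "s x = 1 / real n * (\<Sum>k<n. indicat_real (U k) x)" for x
    have U: "openin T (U k)" for k
    proof -
      have "U k = {x \<in> topspace T. f x \<in> {real k / real n <..}}"
        using n by (auto simp: U_def field_simps)
      then show ?thesis
        using openin_continuous_map_preimage[OF f, of "{real k / real n <..}"] by simp
    qed
    have s: "f x \<le> s x" "s x \<le> f x + 1 / real n" if x: "x \<in> topspace T" for x
    proof -
      have "(\<Sum>k<n. indicat_real (U k) x) = (\<Sum>k<n. if real k < real n * f x then 1 else 0)"
        using x by (intro sum.cong) (auto simp: U_def indicator_def)
      moreover have "0 \<le> real n * f x" "real n * f x \<le> real n"
        using f01[OF x] by (auto intro: mult_left_le)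
      ultimately have "real n * f x \<le> (\<Sum>k<n. indicat_real (U k) x)"
          "(\<Sum>k<n. indicat_real (U k) x) \<le> real n * f x + 1"
        using count_below_bounds[of "real n * f x" n] by auto
      then show "f x \<le> s x" "s x \<le> f x + 1 / real n"
        using n by (auto simp: s_def field_simps)
    qed
    have bs: "bounded (s ` topspace T)"
      unfolding s_def by (intro bounded_scale_image bounded_sum_image bounded_indicator_image)
    have int_ind: "integrable riesz_measure (indicat_real (U k))" for k
      using openin_sets_riesz_measure[OF U] by (simp add: M.emeasure_finite less_top[symmetric])
    have "(\<integral>x. f x \<partial>riesz_measure) \<le> (\<integral>x. s x \<partial>riesz_measure)"
      unfolding s_def using s int int_ind
      by (intro integral_mono) (auto simp: space_riesz_measure s_def)
    also have "\<dots> = 1 / real n * (\<Sum>k<n. measure riesz_measure (U k))"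
      unfolding s_def using int_ind openin_sets_riesz_measure[OF U]
      by (simp add: Bochner_Integration.integral_sum)
    also have "\<dots> \<le> 1 / real n * (\<Sum>k<n. mass (U k))"
      by (intro mult_left_mono sum_mono measure_riesz_open_le U) simp
    also have "\<dots> = L s"
      unfolding s_def mass_def
      by (subst scale) (auto intro!: bounded_sum_image bounded_indicator_image simp: sum bounded_indicator_image)
    also have "\<dots> \<le> L (\<lambda>x. f x + 1 / real n * 1)"
      using s by (intro mono bs bounded_add_image bf bounded_const_image) simp
    also have "\<dots> = L f + L (\<lambda>_. 1) / real n"
      using add[OF bf bounded_const_image] scale[OF bounded_const_image, of "1 / real n" 1] by simp
    finally show ?thesis .
  qed
  have "(\<lambda>n. L f + L (\<lambda>_. 1) / real n) \<longlonglongrightarrow> L f + 0"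
    by (intro tendsto_intros lim_const_over_n)
  then show ?thesis
    using approx by (intro LIMSEQ_le_const[of _ "L f"]) (auto intro!: exI[of _ 1])
qed

text \<open>The inequality for functions with values in [0, 1] extends to bounded continuous
  functions by an affine rescaling; applied to \<open>f\<close> and to its negative it gives
  equality.\<close>

lemma integral_riesz:
  assumes f: "continuous_map T euclideanreal f"
  shows "(\<integral>x. f x \<partial>riesz_measure) = L f"
proof -
  interpret M: finite_measure riesz_measure by (rule finite_measure_riesz_measure)
  have "compactin euclidean (f ` topspace T)"
    using image_compactin[OF _ f] compact by (simp add: compact_space_def)
  then have bf: "bounded (f ` topspace T)" by (simp add: compact_imp_bounded)
  then obtain b where b: "b > 0" "\<And>x. x \<in> topspace T \<Longrightarrow> \<bar>f x\<bar> \<le> b"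
    by (auto simp: bounded_pos)
  have int: "integrable riesz_measure f"
    using b measurable_radon_continuous[OF radon_on_riesz_measure f]
    by (intro M.integrable_const_bound[of _ b] AE_I2) (auto simp: space_riesz_measure)
  have le: "(\<integral>x. g x \<partial>riesz_measure) \<le> L g"
    if g: "continuous_map T euclideanreal g" "integrable riesz_measure g"
      "\<And>x. x \<in> topspace T \<Longrightarrow> \<bar>g x\<bar> \<le> b" for g
  proof -
    \<comment> \<open>This maps \<open>[-b, b]\<close> into \<open>[0, 1]\<close>. The added
      constant contributes equally to both sides, since the total mass is
      \<open>L (\<lambda>_. 1)\<close>.\<close>
    let ?h = "\<lambda>x. 1 / (2 * b) * g x + 1 / 2 * 1"
    have bg: "bounded (g ` topspace T)" by (rule boundedI[of _ b]) (use g in auto)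
    have "(\<integral>x. ?h x \<partial>riesz_measure) \<le> L ?h"
    proof (rule integral_riesz_le)
      show "continuous_map T euclideanreal ?h"
        using g(1) by (intro continuous_map_add continuous_map_real_mult) auto
      show "0 \<le> ?h x \<and> ?h x \<le> 1" if "x \<in> topspace T" for x
        using g(3)[OF that] b(1) by (auto simp: field_simps abs_le_iff)
    qed
    also have "L ?h = 1 / (2 * b) * L g + 1 / 2 * L (\<lambda>_. 1)"
      using add[OF bounded_scale_image[OF bg] bounded_scale_image[OF bounded_const_image]]
        scale[OF bg, of "1 / (2 * b)"] scale[OF bounded_const_image, of "1/2" 1] by metis
    also have "(\<integral>x. ?h x \<partial>riesz_measure) = 1 / (2 * b) * (\<integral>x. g x \<partial>riesz_measure) + 1 / 2 * L (\<lambda>_. 1)"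
      using g(2) by (simp add: measure_riesz_space space_riesz_measure)
    finally show ?thesis using b(1) by (simp add: divide_le_cancel)
  qed
  have "(\<integral>x. - f x \<partial>riesz_measure) \<le> L (\<lambda>x. - f x)"
    using f int b(2) by (intro le continuous_intros) auto
  moreover have "L (\<lambda>x. - f x) = - L f" using scale[OF bf, of "-1"] by simp
  ultimately show ?thesis using le[OF f int b(2)] by simp
qed

end

section \<open>Representation by measures on the dual\<close>

text \<open>Tychonoff's theorem. The normalized positive definite functions, the dual and the means
  are all closed subsets of such boxes.\<close>

lemma compact_function_box:
  fixes S :: "'a \<Rightarrow> 'b::topological_space set"
  assumes "\<And>x. compact (S x)"
  shows "compact {f. \<forall>x. f x \<in> S x}"
proof -
  have "compactin (product_topology (\<lambda>_. euclidean) UNIV) (PiE UNIV S)"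
    using assms by (simp add: compactin_PiE)
  moreover have "PiE UNIV S = {f. \<forall>x. f x \<in> S x}" by (auto simp: PiE_def)
  ultimately show ?thesis by (simp add: euclidean_product_topology)
qed

lemma closed_pos_def: "closed {\<phi> :: 'g::ab_group_add \<Rightarrow> quat. pos_def \<phi>}"
  unfolding pos_def_def qnonneg_real_def
  by (intro closed_Collect_all closed_Collect_conj closed_Collect_eq closed_Collect_le
      continuous_intros qmul.continuous_on continuous_on_product_coordinates)

lemma closed_pos_def_normalized: "closed (pos_def_normalized :: ('g::ab_group_add \<Rightarrow> quat) set)"
  unfolding pos_def_normalized_def
  by (intro closed_Collect_conj closed_pos_def closed_Collect_eq continuous_intros
      continuous_on_product_coordinates)

lemma compact_pos_def_normalized: "compact (pos_def_normalized :: ('g::ab_group_add \<Rightarrow> quat) set)"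
proof -
  have "pos_def_normalized \<subseteq> {\<phi> :: 'g \<Rightarrow> quat. \<forall>x. \<phi> x \<in> cball 0 1}"
    using norm_pos_def_le by (force simp: pos_def_normalized_def)
  then have "pos_def_normalized = {\<phi> :: 'g \<Rightarrow> quat. \<forall>x. \<phi> x \<in> cball 0 1} \<inter> pos_def_normalized" by blast
  then show ?thesis
    using compact_Int_closed[OF compact_function_box[of "\<lambda>_. cball 0 1"] closed_pos_def_normalized]
    by (metis compact_cball)
qed

section \<open>The dual as a compact Hausdorff space and the identities for its elements\<close>

lemma compact_qdual: "compact (qdual :: ('g::ab_group_add \<Rightarrow> quat) set)"
proof -
  have "closed {\<gamma> :: 'g \<Rightarrow> quat. \<forall>a b. \<gamma> (a + b) = qmul (\<gamma> a) (\<gamma> b)}"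
    by (intro closed_Collect_all closed_Collect_eq qmul.continuous_on continuous_on_product_coordinates)
  from compact_Int_closed[OF compact_function_box[of "\<lambda>_. sphere 0 1"] this]
  have "compact ({\<gamma> :: 'g \<Rightarrow> quat. \<forall>x. \<gamma> x \<in> sphere 0 1} \<inter> {\<gamma>. \<forall>a b. \<gamma> (a + b) = qmul (\<gamma> a) (\<gamma> b)})"
    by simp
  moreover have "qdual = {\<gamma> :: 'g \<Rightarrow> quat. \<forall>x. \<gamma> x \<in> sphere 0 1} \<inter> {\<gamma>. \<forall>a b. \<gamma> (a + b) = qmul (\<gamma> a) (\<gamma> b)}"
    by (auto simp: qdual_def)
  ultimately show ?thesis by simp
qed

lemma topspace_qdual_top [simp]: "topspace qdual_top = qdual"
  by (simp add: qdual_top_def)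

lemma compact_space_qdual_top: "compact_space (qdual_top :: ('g::ab_group_add \<Rightarrow> quat) topology)"
  using compact_qdual unfolding qdual_top_def euclidean_product_topology
  by (intro compact_space_subtopology) simp

lemma Hausdorff_space_qdual_top: "Hausdorff_space (qdual_top :: ('g::ab_group_add \<Rightarrow> quat) topology)"
  unfolding qdual_top_def
  by (intro Hausdorff_space_subtopology) (simp add: Hausdorff_space_product_topology Hausdorff_space_euclidean)

lemma continuous_map_qdual_eval:
  "continuous_map (qdual_top :: ('g::ab_group_add \<Rightarrow> quat) topology) euclidean (\<lambda>\<gamma>. \<gamma> g)"
  unfolding qdual_top_def
  by (intro continuous_map_from_subtopology continuous_map_product_projection) simp

lemma continuous_map_qdual_component:
  "continuous_map (qdual_top :: ('g::ab_group_add \<Rightarrow> quat) topology) euclideanreal (\<lambda>\<gamma>. \<gamma> g $ n)"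
proof -
  have "continuous_map euclidean euclideanreal (\<lambda>v :: quat. v $ n)"
    by (simp add: continuous_intros)
  from continuous_map_compose[OF continuous_map_qdual_eval this] show ?thesis
    by (simp add: o_def)
qed

lemma qdual_norm: "\<gamma> \<in> qdual \<Longrightarrow> norm (\<gamma> a) = 1"
  by (simp add: qdual_def)

lemma qdual_add: "\<gamma> \<in> qdual \<Longrightarrow> \<gamma> (a + b) = qmul (\<gamma> a) (\<gamma> b)"
  by (simp add: qdual_def)

lemma qdual_zero:
  assumes "\<gamma> \<in> qdual"
  shows "\<gamma> 0 = axis 1 1"
proof -
  have "qmul (qcnj (\<gamma> 0)) (\<gamma> 0) = qmul (qcnj (\<gamma> 0)) (qmul (\<gamma> 0) (\<gamma> 0))"
    using qdual_add[OF assms, of 0 0] by simp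
  then show ?thesis
    using qdual_norm[OF assms, of 0] by (simp add: qmul_qcnj flip: qmul_assoc)
qed

lemma qdual_uminus:
  assumes "\<gamma> \<in> qdual"
  shows "\<gamma> (- a) = qcnj (\<gamma> a)"
proof -
  have "qmul (qmul (\<gamma> (- a)) (\<gamma> a)) (qcnj (\<gamma> a)) = qcnj (\<gamma> a)"
    unfolding qdual_add[OF assms, symmetric] by (simp add: qdual_zero[OF assms])
  then show ?thesis using qdual_norm[OF assms, of a] by (simp add: qmul_assoc qmul_qcnj)
qed

lemma one_in_qdual: "(\<lambda>_. axis 1 1) \<in> qdual"
  by (simp add: qdual_def)

text \<open>The value at \<open>g j - g i\<close> factors as the conjugate of
  \<open>\<gamma> (g i)\<close> times \<open>\<gamma> (g j)\<close>, so the double sum is a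
  conjugate \<open>s*\<close> times \<open>s\<close>.\<close>

lemma qdual_quadratic_form:
  assumes "\<gamma> \<in> qdual"
  shows "(\<Sum>i\<in>I. \<Sum>j\<in>I. qmul (qmul (qcnj (q i)) (\<gamma> (g j - g i))) (q j)) =
    axis 1 ((norm (\<Sum>i\<in>I. qmul (\<gamma> (g i)) (q i)))\<^sup>2)"
proof -
  have "qmul (qmul (qcnj (q i)) (\<gamma> (g j - g i))) (q j) =
      qmul (qcnj (qmul (\<gamma> (g i)) (q i))) (qmul (\<gamma> (g j)) (q j))" for i j
    using qdual_add[OF assms, of "- g i" "g j"]
    by (simp add: qdual_uminus[OF assms] qcnj_qmul qmul_assoc)
  then show ?thesis
    by (simp add: qmul_qcnj(1)[symmetric] linear_sum[OF linear_qcnj] qmul.sum_left qmul.sum_right)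
       (rule sum.swap)
qed

text \<open>The quadratic form is real-linear in finitely many values of \<phi>, so it passes under
  the integral, where \<open>qdual_quadratic_form\<close> makes the integrand a nonnegative
  real.\<close>

lemma pos_def_radon_integral:
  fixes \<phi> :: "'g::ab_group_add \<Rightarrow> quat"
  assumes fin: "finite_measure M" and rad: "radon_on qdual_top M"
    and int: "\<And>g n. \<phi> g $ n = (\<integral>\<gamma>. \<gamma> g $ n \<partial>M)"
  shows "pos_def \<phi>"
  unfolding pos_def_def
proof (intro allI)
  fix k :: nat and g :: "nat \<Rightarrow> 'g" and q :: "nat \<Rightarrow> quat"
  have space: "space M = qdual" using rad by (simp add: radon_on_def)
  have I: "integrable M (\<lambda>\<gamma>. \<gamma> a)" for a
    using measurable_radon_continuous[OF rad continuous_map_qdual_eval, of a]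
    by (intro finite_measure.integrable_const_bound[OF fin, of _ 1] AE_I2)
       (auto simp: space qdual_norm)
  have \<phi>: "\<phi> a = (\<integral>\<gamma>. \<gamma> a \<partial>M)" for a
    unfolding vec_eq_iff int
    using integral_bounded_linear[OF bounded_linear_vec_nth I] by simp
  have bl: "bounded_linear (\<lambda>v. qmul (qmul a v) b)" for a b
    by (rule bounded_linear_compose[OF qmul.bounded_linear_left qmul.bounded_linear_right])
  let ?f = "\<lambda>\<gamma>. \<Sum>i\<in>{1..k}. \<Sum>j\<in>{1..k}. qmul (qmul (qcnj (q i)) (\<gamma> (g j - g i))) (q j)"
  have If: "integrable M ?f"
    by (intro Bochner_Integration.integrable_sum integrable_bounded_linear[OF bl] I)
  have "?f \<phi> = (\<integral>\<gamma>. ?f \<gamma> \<partial>M)"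
    by (subst Bochner_Integration.integral_sum;
        (intro Bochner_Integration.integrable_sum integrable_bounded_linear[OF bl] I)?)
       (simp add: \<phi> integral_bounded_linear[OF bl I] Bochner_Integration.integral_sum
          integrable_bounded_linear[OF bl I])
  then have comp: "?f \<phi> $ n = (\<integral>\<gamma>. ?f \<gamma> $ n \<partial>M)" for n
    by (simp only: integral_bounded_linear[OF bounded_linear_vec_nth If])
  have fn: "?f \<gamma> $ n = axis 1 ((norm (\<Sum>i\<in>{1..k}. qmul (\<gamma> (g i)) (q i)))\<^sup>2) $ n" if "\<gamma> \<in> space M" for \<gamma> n
    using qdual_quadratic_form[where \<gamma> = \<gamma> and I = "{1..k}" and q = q and g = g] that space by simp
  have eq: "?f \<phi> $ n = (\<integral>\<gamma>. axis 1 ((norm (\<Sum>i\<in>{1..k}. qmul (\<gamma> (g i)) (q i)))\<^sup>2) $ n \<partial>M)" for n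
    unfolding comp by (rule Bochner_Integration.integral_cong[OF refl fn])
  show "qnonneg_real (?f \<phi>)"
    unfolding qnonneg_real_def eq by simp
qed

section \<open>Means on bounded functions and their barycenters\<close>

definition means :: "'a set \<Rightarrow> (('a \<Rightarrow> real) \<Rightarrow> real) set" where
  "means X = {L. positive_functional X L \<and> L (\<lambda>_. 1) = 1 \<and> (\<forall>f. \<not> bounded (f ` X) \<longrightarrow> L f = 0)}"

text \<open>The Banach-Alaoglu argument: every value \<open>L f\<close> is confined to a compact
  interval, and the defining conditions are closed under pointwise convergence.\<close>

lemma compact_means: "compact (means X)"
proof -
  \<comment> \<open>The radius 0 for unbounded \<open>f\<close> matches the default value prescribed
    in \<open>means\<close>, without which these coordinates would be unconstrained.\<close>
  define b where "b f = (if bounded (f ` X) then (SOME b. \<forall>x\<in>X. \<bar>f x\<bar> \<le> b) else 0)" for f :: "'a \<Rightarrow> real"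
  have b: "\<bar>f x\<bar> \<le> b f" if "bounded (f ` X)" "x \<in> X" for f x
  proof -
    have "\<exists>b. \<forall>x\<in>X. \<bar>f x\<bar> \<le> b" using that(1) by (auto simp: bounded_iff)
    from someI_ex[OF this] show ?thesis using that by (simp add: b_def)
  qed
  have "L f \<in> cball 0 (b f)" if L: "L \<in> means X" for L f
  proof (cases "bounded (f ` X)")
    case True
    then show ?thesis
      using positive_functional.abs_le[of X L f "b f"] L b by (simp add: means_def)
  next
    case False
    then show ?thesis using L by (simp add: means_def b_def)
  qed
  then have eq: "means X = {L. \<forall>f. L f \<in> cball 0 (b f)} \<inter> means X" by blast
  have "closed (means X)"
    unfolding means_def positive_functional_def all_conj_distrib imp_conjL
    by (intro closed_Collect_all closed_Collect_conj closed_Collect_imp open_Collect_const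
        closed_Collect_eq closed_Collect_le closed_Collect_const
        continuous_intros continuous_on_product_coordinates)
  then have "compact ({L. \<forall>f. L f \<in> cball 0 (b f)} \<inter> means X)"
    by (intro compact_Int_closed compact_function_box compact_cball)
  then show ?thesis by (subst eq)
qed

text \<open>The Dirac mean at \<open>x\<close>, cut off to the default value on unbounded
  functions.\<close>

lemma eval_in_means:
  assumes "x \<in> X"
  shows "(\<lambda>f. if bounded (f ` X) then f x else 0) \<in> means X"
proof -
  have 1: "bounded ((\<lambda>_. 1::real) ` X)" by (rule boundedI[of _ 1]) auto
  have "positive_functional X (\<lambda>f. if bounded (f ` X) then f x else 0)"
  proof
    fix f g :: "'a \<Rightarrow> real" and c :: real
    assume f: "bounded (f ` X)"
    then have "bounded ((\<lambda>x. c * f x) ` X)"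
      using bounded_scaling[of "f ` X" c] by (simp add: image_image)
    then show "(if bounded ((\<lambda>x. c * f x) ` X) then c * f x else 0) = c * (if bounded (f ` X) then f x else 0)"
      using f by simp
    show "0 \<le> (if bounded (f ` X) then f x else 0)" if "\<And>x. x \<in> X \<Longrightarrow> 0 \<le> f x"
      using that assms by simp
    assume g: "bounded (g ` X)"
    show "(if bounded ((\<lambda>x. f x + g x) ` X) then f x + g x else 0) =
        (if bounded (f ` X) then f x else 0) + (if bounded (g ` X) then g x else 0)"
      using f g bounded_plus_comp[OF f g] by simp
  qed
  then show ?thesis using 1 by (simp add: means_def)
qed

lemma convex_comb_means:
  assumes "L \<in> means X" "L' \<in> means X" "0 \<le> t" "t \<le> 1"
  shows "(\<lambda>f. (1 - t) * L f + t * L' f) \<in> means X"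
proof -
  interpret L: positive_functional X L using assms by (simp add: means_def)
  interpret L': positive_functional X L' using assms by (simp add: means_def)
  have "positive_functional X (\<lambda>f. (1 - t) * L f + t * L' f)"
  proof
    fix f g :: "'a \<Rightarrow> real" and c :: real
    assume f: "bounded (f ` X)"
    show "(1 - t) * L (\<lambda>x. c * f x) + t * L' (\<lambda>x. c * f x) = c * ((1 - t) * L f + t * L' f)"
      by (simp add: L.scale[OF f] L'.scale[OF f] algebra_simps)
    show "0 \<le> (1 - t) * L f + t * L' f" if "\<And>x. x \<in> X \<Longrightarrow> 0 \<le> f x"
      using assms(3,4) L.nonneg[OF f that] L'.nonneg[OF f that] by simp
    assume g: "bounded (g ` X)"
    show "(1 - t) * L (\<lambda>x. f x + g x) + t * L' (\<lambda>x. f x + g x) =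
        (1 - t) * L f + t * L' f + ((1 - t) * L g + t * L' g)"
      by (simp add: L.add[OF f g] L'.add[OF f g] algebra_simps)
  qed
  then show ?thesis using assms by (simp add: means_def)
qed

text \<open>The integral of \<open>\<gamma> g\<close> over \<gamma> against \<open>L\<close>, taken
  componentwise.\<close>

definition barycenter :: "((('g \<Rightarrow> quat) \<Rightarrow> real) \<Rightarrow> real) \<Rightarrow> 'g \<Rightarrow> quat" where
  "barycenter L g = (\<chi> n. L (\<lambda>\<gamma>. \<gamma> g $ n))"

lemma continuous_on_barycenter: "continuous_on UNIV (\<lambda>L. barycenter L g)"
  unfolding barycenter_def
  by (intro continuous_on_vec_lambda continuous_on_product_coordinates)

lemma bounded_qdual_component: "bounded ((\<lambda>\<gamma>. \<gamma> g $ n) ` qdual)"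
proof (rule boundedI)
  show "norm y \<le> 1" if "y \<in> (\<lambda>\<gamma>. \<gamma> g $ n) ` qdual" for y
    using that by (auto intro: order_trans[OF component_le_norm_cart] simp: qdual_norm)
qed

text \<open>The expression is the change of a squared distance when a minimizer is moved by
  \<open>t\<close> along a segment; its derivative at 0, which is \<open>- 2 * A\<close>, cannot be
  negative.\<close>

lemma first_variation_nonpos:
  fixes A B :: real
  assumes "\<And>t. 0 < t \<Longrightarrow> t \<le> 1 \<Longrightarrow> 0 \<le> t\<^sup>2 * B - 2 * t * A"
  shows "A \<le> 0"
proof (rule ccontr)
  assume "\<not> A \<le> 0"
  then have A: "A > 0" by simp
  \<comment> \<open>Small enough for \<open>t * B \<le> A\<close>, which makes
    \<open>t * B - 2 * A\<close> negative.\<close>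
  define t where "t = min 1 (A / (\<bar>B\<bar> + 1))"
  have t: "0 < t" "t \<le> 1" using A by (auto simp: t_def)
  have "t \<le> A / (\<bar>B\<bar> + 1)" by (simp add: t_def)
  then have "t * (\<bar>B\<bar> + 1) \<le> A" by (simp add: pos_le_divide_eq)
  moreover have "t * B \<le> t * (\<bar>B\<bar> + 1)" using t by (intro mult_left_mono) auto
  ultimately have "t * B \<le> A" by simp
  moreover have "0 \<le> t * (t * B - 2 * A)" using assms[OF t] by (simp add: power2_eq_square algebra_simps)
  then have "0 \<le> t * B - 2 * A" using t by (simp add: zero_le_mult_iff)
  ultimately show False using A by simp
qed

text \<open>Choose the mean \<open>L\<close> whose barycenter is nearest to \<phi> on
  \<open>F\<close>, and let \<open>l\<close> be the inner product with the residual
  \<open>f\<close>. Moving \<open>L\<close> towards Dirac means shows that \<open>l\<close> on the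
  dual is at most its value at the barycenter. Over the normalized positive definite functions
  \<open>l\<close> is maximal at an extreme point, which lies in the dual; so the bound extends to
  \<phi> and says that the sum of squares of \<open>f\<close> is at most 0.\<close>

lemma barycenter_agrees_on_finite:
  fixes \<phi> :: "'g::ab_group_add \<Rightarrow> quat"
  assumes \<phi>: "\<phi> \<in> pos_def_normalized" and F: "finite F"
  shows "\<exists>L\<in>means qdual. \<forall>g\<in>F. barycenter L g = \<phi> g"
proof -
  let ?D = "\<lambda>L. \<Sum>g\<in>F. (norm (\<phi> g - barycenter L g))\<^sup>2"
  have "means (qdual :: ('g \<Rightarrow> quat) set) \<noteq> {}" using eval_in_means[OF one_in_qdual] by blast
  moreover have "continuous_on (means (qdual :: ('g \<Rightarrow> quat) set)) ?D"
    by (intro continuous_intros continuous_on_subset[OF continuous_on_barycenter]) auto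
  ultimately obtain L where L: "L \<in> means qdual" and min: "\<And>L'. L' \<in> means qdual \<Longrightarrow> ?D L \<le> ?D L'"
    using continuous_attains_inf[OF compact_means] by blast
  define f where "f g = \<phi> g - barycenter L g" for g
  define l where "l p = (\<Sum>g\<in>F. f g \<bullet> p g)" for p :: "'g \<Rightarrow> quat"
  have var: "l \<gamma> \<le> l (barycenter L)" if \<gamma>: "\<gamma> \<in> qdual" for \<gamma>
  proof -
    define B where "B = (\<Sum>g\<in>F. (norm (\<gamma> g - barycenter L g))\<^sup>2)"
    have "l \<gamma> - l (barycenter L) \<le> 0"
    proof (rule first_variation_nonpos)
      fix t :: real assume t: "0 < t" "t \<le> 1"
      define E where "E = (\<lambda>h. if bounded (h ` qdual) then h \<gamma> else (0::real))"
      \<comment> \<open>A competitor for the minimum: \<open>L\<close> moved by the fraction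
        \<open>t\<close> towards the Dirac mean at \<gamma>.\<close>
      define L' where "L' = (\<lambda>h. (1 - t) * L h + t * E h)"
      have "L' \<in> means qdual"
        unfolding L'_def E_def using t by (intro convex_comb_means L eval_in_means \<gamma>) auto
      then have le: "?D L \<le> ?D L'" by (rule min)
      have b: "barycenter L' g = (1 - t) *\<^sub>R barycenter L g + t *\<^sub>R \<gamma> g" for g
        by (simp add: vec_eq_iff barycenter_def L'_def E_def bounded_qdual_component)
      have "?D L' = (\<Sum>g\<in>F. (norm (f g))\<^sup>2 + t\<^sup>2 * (norm (\<gamma> g - barycenter L g))\<^sup>2
          - 2 * t * (f g \<bullet> \<gamma> g - f g \<bullet> barycenter L g))"
      proof (intro sum.cong refl)
        fix g
        have "\<phi> g - barycenter L' g = f g - t *\<^sub>R (\<gamma> g - barycenter L g)"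
          by (simp add: b f_def algebra_simps)
        moreover have "(norm (u - t *\<^sub>R v))\<^sup>2 = (norm u)\<^sup>2 + t\<^sup>2 * (norm v)\<^sup>2 - 2 * t * (u \<bullet> v)" for u v :: quat
          unfolding power2_norm_eq_inner
          by (simp add: inner_diff_left inner_diff_right inner_commute[of v u] power2_eq_square algebra_simps)
        ultimately show "(norm (\<phi> g - barycenter L' g))\<^sup>2 = (norm (f g))\<^sup>2 + t\<^sup>2 * (norm (\<gamma> g - barycenter L g))\<^sup>2
          - 2 * t * (f g \<bullet> \<gamma> g - f g \<bullet> barycenter L g)"
          by (simp only: inner_diff_right)
      qed
      also have "\<dots> = ?D L + t\<^sup>2 * B - 2 * t * (l \<gamma> - l (barycenter L))"
        by (simp add: sum.distrib sum_subtractf sum_distrib_left B_def l_def f_def right_diff_distrib)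
      finally show "0 \<le> t\<^sup>2 * B - 2 * t * (l \<gamma> - l (barycenter L))" using le by simp
    qed
    then show ?thesis by simp
  qed
  have "continuous_on UNIV l"
    unfolding l_def by (intro continuous_intros continuous_on_product_coordinates)
  moreover have "l (\<lambda>x. (1 - t) *\<^sub>R p x + t *\<^sub>R q x) = (1 - t) * l p + t * l q" for p q t
    by (simp add: l_def inner_add_right sum.distrib sum_distrib_left)
  moreover have "pos_def_normalized \<noteq> ({} :: ('g \<Rightarrow> quat) set)" using \<phi> by blast
  ultimately obtain \<psi> where \<psi>: "extreme_in pos_def_normalized \<psi>" "\<And>p. p \<in> pos_def_normalized \<Longrightarrow> l p \<le> l \<psi>"
    using extreme_point_maximizes[OF compact_pos_def_normalized closed_pos_def_normalized, of l] by blast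
  have "l \<phi> \<le> l \<psi>" by (rule \<psi>(2)[OF \<phi>])
  also have "\<dots> \<le> l (barycenter L)" by (rule var[OF extreme_pos_def_in_qdual[OF \<psi>(1)]])
  finally have "l \<phi> - l (barycenter L) \<le> 0" by simp
  also have "l \<phi> - l (barycenter L) = (\<Sum>g\<in>F. (norm (f g))\<^sup>2)"
    by (simp add: l_def f_def sum_subtractf[symmetric] power2_norm_eq_inner inner_diff_right)
  finally have "(\<Sum>g\<in>F. (norm (f g))\<^sup>2) = 0" by (intro antisym sum_nonneg) auto
  then have "\<forall>g\<in>F. f g = 0" using F by (simp add: sum_nonneg_eq_0_iff)
  then show ?thesis using L by (auto simp: f_def)
qed

text \<open>Compactness of the means passes from finite subsets of the group to the whole group,
  through the finite intersection property.\<close>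

lemma pos_def_normalized_barycenter:
  fixes \<phi> :: "'g::ab_group_add \<Rightarrow> quat"
  assumes \<phi>: "\<phi> \<in> pos_def_normalized"
  obtains L where "L \<in> means qdual" "\<And>g. barycenter L g = \<phi> g"
proof -
  have "means qdual \<inter> \<Inter>(range (\<lambda>g. {L. barycenter L g = \<phi> g})) \<noteq> {}"
  proof (rule compact_imp_fip[OF compact_means])
    show "closed S" if "S \<in> range (\<lambda>g. {L. barycenter L g = \<phi> g})" for S
      using that by (auto intro!: closed_Collect_eq continuous_on_barycenter continuous_intros)
    fix \<F> assume "finite \<F>" "\<F> \<subseteq> range (\<lambda>g. {L. barycenter L g = \<phi> g})"
    then obtain F where F: "finite F" "\<F> = (\<lambda>g. {L. barycenter L g = \<phi> g}) ` F"
      by (meson finite_subset_image)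
    obtain L where "L \<in> means qdual" "\<forall>g\<in>F. barycenter L g = \<phi> g"
      using barycenter_agrees_on_finite[OF \<phi> F(1)] by blast
    then have "L \<in> means qdual \<inter> \<Inter>\<F>" using F(2) by simp
    then show "means qdual \<inter> \<Inter>\<F> \<noteq> {}" by blast
  qed
  then show ?thesis using that by auto
qed

text \<open>Rescaling by \<open>\<phi>(0)\<close> reduces to the normalized case. If
  \<open>\<phi>(0) = 0\<close>, the bound \<open>|\<phi>(g)| \<le> \<phi>(0)\<close> makes \<phi>
  zero and the zero functional serves.\<close>

lemma pos_def_positive_functional:
  fixes \<phi> :: "'g::ab_group_add \<Rightarrow> quat"
  assumes pd: "pos_def \<phi>"
  obtains L where "positive_functional qdual L" "\<And>g n. L (\<lambda>\<gamma>. \<gamma> g $ n) = \<phi> g $ n"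
proof -
  define c where "c = \<phi> 0 $ 1"
  have c: "0 \<le> c" using pos_def_zero[OF pd] by (simp add: c_def qnonneg_real_def)
  show ?thesis
  proof (cases "c = 0")
    case True
    have "\<phi> g = 0" for g using norm_pos_def_le[OF pd, of g] True by (simp add: c_def)
    moreover have "positive_functional qdual (\<lambda>_. 0)" by unfold_locales auto
    ultimately show ?thesis using that[of "\<lambda>_. 0"] by simp
  next
    case False
    then have "(\<lambda>x. (1 / c) *\<^sub>R \<phi> x) \<in> pos_def_normalized"
      using c by (intro pos_def_normalize[OF pd]) (auto simp: c_def)
    then obtain L where L: "L \<in> means qdual" "\<And>g. barycenter L g = (1 / c) *\<^sub>R \<phi> g"
      by (rule pos_def_normalized_barycenter) blast
    interpret L: positive_functional qdual L using L(1) by (simp add: means_def)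
    have "positive_functional qdual (\<lambda>f. c * L f)"
      by unfold_locales (use c in \<open>auto simp: L.add L.scale algebra_simps intro!: mult_nonneg_nonneg L.nonneg\<close>)
    moreover have "c * L (\<lambda>\<gamma>. \<gamma> g $ n) = \<phi> g $ n" for g n
    proof -
      have "L (\<lambda>\<gamma>. \<gamma> g $ n) = barycenter L g $ n" by (simp add: barycenter_def)
      then show ?thesis using False by (simp add: L(2))
    qed
    ultimately show ?thesis by (rule that)
  qed
qed

theorem mainTheorem12:
  fixes \<phi> :: "'g::ab_group_add \<Rightarrow> quat"
  shows "pos_def \<phi> \<longleftrightarrow>
    (\<exists>M :: ('g \<Rightarrow> quat) measure.
       finite_measure M \<and> radon_on qdual_top M \<and>
       (\<forall>g (n::4). \<phi> g $ n = (\<integral>\<gamma>. \<gamma> g $ n \<partial>M)))"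
proof
  assume "pos_def \<phi>"
  then obtain L where L: "positive_functional qdual L" "\<And>g n. L (\<lambda>\<gamma>. \<gamma> g $ n) = \<phi> g $ n"
    by (rule pos_def_positive_functional) blast
  then interpret compact_positive_functional qdual_top L
    by (simp add: compact_positive_functional_def compact_positive_functional_axioms_def
        compact_space_qdual_top Hausdorff_space_qdual_top)
  show "\<exists>M. finite_measure M \<and> radon_on qdual_top M \<and> (\<forall>g n. \<phi> g $ n = (\<integral>\<gamma>. \<gamma> g $ n \<partial>M))"
    by (intro exI[of _ riesz_measure] conjI allI finite_measure_riesz_measure radon_on_riesz_measure)
       (simp add: integral_riesz[OF continuous_map_qdual_component] L(2))
next
  assume "\<exists>M. finite_measure M \<and> radon_on qdual_top M \<and> (\<forall>g n. \<phi> g $ n = (\<integral>\<gamma>. \<gamma> g $ n \<partial>M))"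
  then show "pos_def \<phi>" using pos_def_radon_integral by blast
qed

end
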